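(* Let $c>1$ be a constant. Then for any $p=p(n)$ with $\frac{c\ln n}{n}<p<\frac12$, $G(n,p)$ is almost surely non-singular; that is, the probability that the adjacency matrix of $G(n,p)$ is non-singular tends to $1$ as $n\to\infty$.
   Context: $G(n,p)$ is the Erdős–Rényi random graph on the vertex set $\{1,\dots,n\}$: each pair of distinct vertices is joined by an edge independently with probability $p$. The adjacency matrix of a graph on $\{1,\dots,n\}$ is the symmetric $n\times n$ $(0,1)$ matrix whose $ij$ entry is $1$ if and only if $i$ and $j$ are adjacent; a graph is called non-singular if its adjacency matrix is non-singular over the real numbers. "Almost surely" means with probability tending to $1$ as $n\to\infty$. *)

theory Defs
  imports "HOL-Probability.Probability" "Jordan_Normal_Form.Matrix"
begin

text \<open>
  A simple graph on the vertex set \<open>{1..n}\<close> is represented by its edge set, a set of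
  two-element subsets of \<open>{1..n}\<close>.
\<close>

definition vertex_pairs :: "nat \<Rightarrow> nat set set" where
  "vertex_pairs n = {e. e \<subseteq> {1..n} \<and> card e = 2}"

text \<open>
  \<^const>\<open>bernoulli_pmf\<close> clips its parameter to the unit interval, so \<open>erdos_renyi n p\<close> is the
  random graph \<open>G(n,p)\<close> only for \<open>0 \<le> p \<le> 1\<close>.
\<close>

definition erdos_renyi :: "nat \<Rightarrow> real \<Rightarrow> nat set set pmf" where
  "erdos_renyi n p =
     map_pmf (\<lambda>joined. {e \<in> vertex_pairs n. joined e})
       (Pi_pmf (vertex_pairs n) False (\<lambda>_. bernoulli_pmf p))"

text \<open>Matrix indices start at 0, so index \<open>i\<close> belongs to the vertex \<open>i + 1\<close>.\<close>

definition adjacency_matrix :: "nat \<Rightarrow> nat set set \<Rightarrow> real mat" where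
  "adjacency_matrix n E = mat n n (\<lambda>(i, j). if {i + 1, j + 1} \<in> E then 1 else 0)"

definition nonsingular_graph :: "nat \<Rightarrow> nat set set \<Rightarrow> bool" where
  "nonsingular_graph n E \<longleftrightarrow> invertible_mat (adjacency_matrix n E)"

end

theory Submission
  imports Defs "HOL-Real_Asymp.Real_Asymp" "Jordan_Normal_Form.Determinant"
begin

text \<open>
  Write \<open>A\<close> for the adjacency matrix and call a nonzero vector thin if at most a quarter of its
  coordinates are nonzero.  A singular \<open>A\<close> has a thin vector in its kernel or only vectors that are
  spread out, and the two cases are improbable for different reasons.

  Thin vectors (\<open>thin_null_unlikely\<close>).  For a fixed support \<open>S\<close> the entries of \<open>A\<close> in the columns \<open>S\<close>
  and in the rows outside \<open>S\<close> are independent, so a union bound over \<open>S\<close> is possible.  As long as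
  \<open>p \<cdot> |S|\<close> stays bounded, what prevents a kernel vector with support \<open>S\<close> is a vertex outside \<open>S\<close> with
  exactly one neighbour in \<open>S\<close>: its row meets the vector in a single nonzero term.  For tiny \<open>p \<cdot> |S|\<close>
  such a vertex fails to exist with probability at most \<open>n powr (- d * |S|)\<close> for some \<open>d > 1\<close>, which beats
  the number of sets of size \<open>|S|\<close>; this is where \<open>c > 1\<close> enters, and with \<open>|S| = 1\<close> it is the
  absence of isolated vertices.  For \<open>p \<cdot> |S|\<close> between two constants the failure probability is exponentially
  small in \<open>n\<close>, whereas \<open>|S| = O(n / ln n)\<close> leaves only \<open>exp (o(n))\<close> sets.  For larger \<open>p \<cdot> |S|\<close> the
  Littlewood-Offord inequality says that a random row annihilates a given vector with full support \<open>S\<close>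
  with probability at most \<open>1/64\<close>.  At most \<open>|S|\<close> rows determine what the others have to
  annihilate, so at least about \<open>n/2\<close> rows are left to fail independently, and \<open>4 ^ n\<close> choices of \<open>S\<close> and
  of the determining rows cannot make up for \<open>8 ^ (- n)\<close>.  The argument still works if two rows are
  ignored, and this gives more: for all but few \<open>k\<close>, no thin vector is annihilated by all rows but row \<open>k\<close>.

  Spread vectors (\<open>prob_degenerate_le\<close>).  If a kernel vector has more than \<open>n/4\<close> nonzero
  coordinates, then more than \<open>n/4\<close> vertices \<open>i\<close> admit a kernel vector with nonzero coordinate \<open>i\<close>.  By Markov's
  inequality it suffices to bound the probability of the latter for one vertex \<open>i\<close>.  Let \<open>B\<close> be the
  matrix without row and column \<open>i\<close>, and let \<open>x\<close> be the deleted column; \<open>x\<close> is independent of \<open>B\<close>.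
  If \<open>B\<close> is singular with \<open>B u = 0\<close>, then \<open>x\<close> is orthogonal to \<open>u\<close>, which is improbable since \<open>u\<close> is spread out.  If \<open>B\<close> is
  invertible, then \<open>x\<close> satisfies a quadratic equation whose matrix is the inverse of \<open>B\<close>.  A column of
  that inverse is annihilated by all rows of \<open>B\<close> but one, so most columns are spread out, and
  a quadratic Littlewood-Offord inequality (\<open>quadratic_littlewood_offord\<close>) applies.
\<close>

section \<open>Antichains and binomial point probabilities\<close>

text \<open>
  The LYM inequality, by deleting one point \<open>s\<close> of \<open>S\<close>: a member \<open>A \<noteq> S\<close> survives in \<open>S - {s}\<close> exactly for
  the \<open>s\<close> outside \<open>A\<close>, and because of \<open>binomial_absorb_comp\<close> the average over \<open>s\<close> of the sums for
  \<open>S - {s}\<close> is the sum for \<open>S\<close>.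
\<close>

lemma lym_inequality:
  assumes "finite S" "F \<subseteq> Pow S" "\<And>A B. A \<in> F \<Longrightarrow> B \<in> F \<Longrightarrow> A \<subseteq> B \<Longrightarrow> A = B"
  shows "(\<Sum>A\<in>F. 1 / real (card S choose card A)) \<le> 1"
  using assms
proof (induction S arbitrary: F rule: finite_psubset_induct)
  case (psubset S)
  let ?n = "card S"
  have finF: "finite F"
    using psubset.prems(1) psubset.hyps finite_subset by blast
  show ?case
  proof (cases "S \<in> F")
    case True
    then have "F = {S}"
      using psubset.prems by blast
    then show ?thesis by simp
  next
    case False
    show ?thesis
    proof (cases "S = {}")
      case True
      then show ?thesis using False psubset.prems(1) by (auto simp: subset_singleton_iff)
    next
      case ne: False
      then have npos: "?n > 0" using psubset.hyps by (simp add: card_gt_0_iff)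
      \<comment> \<open>The factor \<open>n - card A\<close> from \<open>binomial_absorb_comp\<close> counts the points outside \<open>A\<close>.\<close>
      have step: "real ?n * (1 / real (?n choose card A)) = (\<Sum>s\<in>{s \<in> S. s \<notin> A}. 1 / real ((?n - 1) choose card A))"
        if "A \<in> F" for A
      proof -
        have A: "A \<subset> S" using that False psubset.prems(1) by blast
        then have lt: "card A < ?n" using psubset.hyps psubset_card_mono by blast
        have fA: "finite A" using A psubset.hyps finite_subset by blast
        have "card {s \<in> S. s \<notin> A} = ?n - card A"
          using A fA by (subst card_Diff_subset[symmetric]) (auto simp: set_diff_eq)
        moreover have "(?n - card A) * (?n choose card A) = ?n * ((?n - 1) choose card A)"
          by (rule binomial_absorb_comp)
        then have "real (?n - card A) * real (?n choose card A) = real ?n * real ((?n - 1) choose card A)"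
          by (metis of_nat_mult)
        moreover have "(?n choose card A) > 0" "((?n - 1) choose card A) > 0"
          using lt by auto
        ultimately show ?thesis by (simp add: field_simps)
      qed
      have "real ?n * (\<Sum>A\<in>F. 1 / real (?n choose card A))
          = (\<Sum>A\<in>F. \<Sum>s\<in>{s \<in> S. s \<notin> A}. 1 / real ((?n - 1) choose card A))"
        unfolding sum_distrib_left using step by (intro sum.cong) auto
      also have "\<dots> = (\<Sum>s\<in>S. \<Sum>A\<in>{A \<in> F. s \<notin> A}. 1 / real ((?n - 1) choose card A))"
        by (rule sum.swap_restrict[OF finF psubset.hyps])
      also have "\<dots> \<le> (\<Sum>s\<in>S. 1)"
      proof (intro sum_mono)
        fix s assume s: "s \<in> S"
        have "(\<Sum>A\<in>{A \<in> F. s \<notin> A}. 1 / real (card (S - {s}) choose card A)) \<le> 1"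
          using s psubset.prems by (intro psubset.IH) auto
        then show "(\<Sum>A\<in>{A \<in> F. s \<notin> A}. 1 / real ((?n - 1) choose card A)) \<le> 1"
          using s psubset.hyps by simp
      qed
      finally have "real ?n * (\<Sum>A\<in>F. 1 / real (?n choose card A)) \<le> real ?n * 1" by simp
      then show ?thesis using npos by (simp only: mult_le_cancel_left_pos of_nat_0_less_iff)
    qed
  qed
qed

text \<open>
  From an index \<open>j\<close> below the mean on, the \<open>i\<close>-th quotient of neighbouring binomial probabilities is at
  least \<open>1 - i / (m * p * (1 - p))\<close>.  Hence \<open>s\<close> consecutive probabilities are at least half as
  large as the one at \<open>j\<close>, while their sum is at most 1.
\<close>

lemma binomial_point_prob_below_mean:
  fixes p :: real and m j s :: nat
  assumes p: "0 < p" "p < 1" and s: "0 < s" "real s ^ 2 \<le> m * p * (1 - p)" and j: "real j \<le> m * p"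
  shows "(m choose j) * p ^ j * (1 - p) ^ (m - j) \<le> 2 / s"
proof -
  define q where "q = 1 - p"
  define V where "V = m * p * q"
  define b where "b i = (m choose i) * p ^ i * q ^ (m - i)" for i
  have q: "0 < q" "q < 1" "p + q = 1" using p by (auto simp: q_def)
  have b0: "b i \<ge> 0" for i unfolding b_def using p q by simp
  have sV: "real s ^ 2 \<le> V" using s by (simp add: V_def q_def)
  have sV1: "real s \<le> V" using sV s(1) self_le_power[of "real s" 2] by linarith
  have Vpos: "V > 0" using sV1 s(1) by linarith
  have Vq: "V \<le> m * q" unfolding V_def using p q by (simp add: mult_left_le mult_right_le_one_le mult.commute mult.left_commute mult_left_le_one_le)
  have inm: "j + i < m" if "i < s" for i
  proof -
    have "real (j + i) < m * p + V" using j that sV1 by simp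
    also have "\<dots> \<le> m * p + m * q" using Vq by simp
    also have "\<dots> = m" using q(3) by (metis distrib_left mult.right_neutral)
    finally show ?thesis by simp
  qed
  have ratio: "b (Suc i) * (Suc i * q) = b i * ((real m - i) * p)" if im: "i < m" for i
  proof -
    obtain m' where m': "m = Suc m'" using im by (cases m) auto
    have "Suc i * (m choose Suc i) = (m - i) * (m choose i)"
      using Suc_times_binomial[of i m'] binomial_absorb_comp[of m i] m' by simp
    then have *: "real (Suc i) * real (m choose Suc i) = (real m - i) * real (m choose i)"
      using that by (metis of_nat_mult of_nat_diff less_imp_le)
    have "m - i = Suc (m - Suc i)" using that by simp
    then have "b i * ((real m - i) * p) = ((real m - i) * real (m choose i)) * (p ^ Suc i * q ^ (m - Suc i) * q)"
      unfolding b_def by simp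
    also have "\<dots> = b (Suc i) * (Suc i * q)"
      unfolding *[symmetric] b_def by (simp only: mult_ac)
    finally show ?thesis ..
  qed
  have grow: "b (j + t) \<ge> b j * (1 - real t * (real t + 1) / (2 * V))" if "t < s" for t
    using that
  proof (induction t)
    case 0
    then show ?case by simp
  next
    case (Suc t)
    define r where "r = 1 - (t + 1) / V"
    have tV: "real t + 1 \<le> V" using Suc.prems sV1 by linarith
    then have r0: "r \<ge> 0" unfolding r_def using Vpos by simp
    have pos: "0 < real (Suc (j + t)) * q" using q by simp
    \<comment> \<open>The quotient of neighbouring probabilities decreases in \<open>j\<close>, so \<open>j\<close> equal to the mean is the worst case.\<close>
    have key: "r * (real (Suc (j + t)) * q) \<le> (real m - (j + t)) * p"
    proof -
      have eq: "(real m - (m * p + t)) * p * V - (V - (t + 1)) * ((m * p + t + 1) * q) = V * p + (t + 1)^2 * q"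
      proof -
        have mq: "real m - m * p = m * q" unfolding q_def by (simp add: algebra_simps)
        have "(real m - (m * p + t)) * p = (real m - m * p) * p - t * p" by (simp add: algebra_simps)
        then have e1: "(real m - (m * p + t)) * p = V - t * p"
          unfolding mq V_def by (simp add: mult_ac)
        have e2: "(m * p + t + 1) * q = V + (t + 1) * q" unfolding V_def by (simp add: algebra_simps)
        show ?thesis unfolding e1 e2 unfolding q_def by (simp add: algebra_simps power2_eq_square)
      qed
      have "(V - (t + 1)) * (real (Suc (j + t)) * q) \<le> (V - (t + 1)) * ((m * p + t + 1) * q)"
        using j tV q by (intro mult_left_mono mult_right_mono) auto
      also have "\<dots> \<le> (real m - (m * p + t)) * p * V"
        proof -
        have "0 \<le> V * p + (t + 1)^2 * q" using p q Vpos by simp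
        then show ?thesis using eq by linarith
      qed
      also have "\<dots> \<le> (real m - (j + t)) * p * V"
        using j p Vpos by (intro mult_right_mono) auto
      also have "V - (t + 1) = V * r" unfolding r_def using Vpos by (simp add: field_simps)
      finally have "V * (r * (real (Suc (j + t)) * q)) \<le> V * ((real m - (j + t)) * p)"
        by (simp only: mult_ac)
      then show ?thesis using Vpos by simp
    qed
    have "b (j + t) * (r * (real (Suc (j + t)) * q)) \<le> b (j + t) * ((real m - (j + t)) * p)"
      by (rule mult_left_mono[OF key b0])
    also have "\<dots> = b (Suc (j + t)) * (Suc (j + t) * q)"
      using ratio[of "j + t"] inm[of t] Suc.prems by simp
    finally have "(b (j + t) * r) * (real (Suc (j + t)) * q) \<le> b (Suc (j + t)) * (real (Suc (j + t)) * q)"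
      by (simp only: mult.assoc)
    then have "b (j + t) * r \<le> b (j + Suc t)"
      using pos by (simp only: mult_le_cancel_right_pos add_Suc_right)
    moreover have "b j * (1 - real t * (real t + 1) / (2 * V)) \<le> b (j + t)"
      using Suc.IH Suc.prems by simp
    then have "b j * (1 - real t * (real t + 1) / (2 * V)) * r \<le> b (j + t) * r"
      using r0 by (rule mult_right_mono)
    moreover have "b j * (1 - real (Suc t) * (real (Suc t) + 1) / (2 * V)) \<le> b j * ((1 - real t * (real t + 1) / (2 * V)) * r)"
    proof (intro mult_left_mono b0)
      have "(1 - real t * (real t + 1) / (2 * V)) * r = 1 - real t * (real t + 1) / (2 * V) - (t + 1) / V + real t * (real t + 1) / (2 * V) * ((t + 1) / V)"
      proof -
        have "(1 - z) * (1 - w) = 1 - z - w + z * w" for z w :: real by (simp add: algebra_simps)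
        then show ?thesis unfolding r_def by blast
      qed
      moreover have "real t * (real t + 1) / (2 * V) * ((t + 1) / V) \<ge> 0" using Vpos by simp
      moreover have "real (Suc t) * (real (Suc t) + 1) / (2 * V) = real t * (real t + 1) / (2 * V) + (t + 1) / V"
        using Vpos by (simp add: field_simps)
      ultimately show "1 - real (Suc t) * (real (Suc t) + 1) / (2 * V) \<le> (1 - real t * (real t + 1) / (2 * V)) * r" by linarith
    qed
    ultimately show ?case by (simp only: mult.assoc)
  qed
  have half: "b j / 2 \<le> b (j + t)" if "t < s" for t
  proof -
    have "real t * (t + 1) \<le> real s * s" using that by (intro mult_mono) auto
    then have "real t * (t + 1) \<le> V" using sV by (simp add: power2_eq_square)
    then have "1 / 2 \<le> 1 - real t * (real t + 1) / (2 * V)" using Vpos by (simp add: field_simps)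
    then have "b j * (1 / 2) \<le> b j * (1 - real t * (real t + 1) / (2 * V))" by (intro mult_left_mono b0)
    then show ?thesis using grow[OF that] by simp
  qed
  have "s * (b j / 2) = (\<Sum>t<s. b j / 2)" by simp
  also have "\<dots> \<le> (\<Sum>t<s. b (j + t))" using half by (intro sum_mono) auto
  also have "\<dots> = (\<Sum>i\<in>(\<lambda>t. j + t) ` {..<s}. b i)" by (subst sum.reindex) auto
  also have "\<dots> \<le> (\<Sum>i\<le>m. b i)"
    by (rule sum_mono2) (use inm b0 in \<open>auto simp: less_imp_le\<close>)
  also have "\<dots> = (p + q) ^ m" unfolding b_def binomial_ring by simp
  also have "\<dots> = 1" using q by simp
  finally have "b j \<le> 2 / s" using s(1) by (simp add: field_simps)
  then show ?thesis unfolding b_def q_def by simp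
qed

text \<open>
  Above the mean, exchanging the roles of success and failure reflects \<open>j\<close> to the other side.
\<close>

lemma binomial_point_prob_le:
  fixes p :: real and m j s :: nat
  assumes p: "0 < p" "p < 1" and s: "0 < s" "real s ^ 2 \<le> m * p * (1 - p)" and jm: "j \<le> m"
  shows "(m choose j) * p ^ j * (1 - p) ^ (m - j) \<le> 2 / s"
proof (cases "real j \<le> m * p")
  case True
  then show ?thesis using binomial_point_prob_below_mean assms by blast
next
  case False
  have "(m choose (m - j)) * (1 - p) ^ (m - j) * (1 - (1 - p)) ^ (m - (m - j)) \<le> 2 / s"
    using assms False jm by (intro binomial_point_prob_below_mean) (auto simp: of_nat_diff algebra_simps)
  then show ?thesis using jm binomial_symmetric[of j m] by (simp add: mult_ac)
qed

text \<open>
  A set of size \<open>j\<close> has weight \<open>p ^ j * (1 - p) ^ (card S - j)\<close>, which is the binomial probability of \<open>j\<close>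
  times \<open>1 / (card S choose j)\<close>; the first factor is at most \<open>2 / s\<close> and the second sums to at most 1 by LYM.
\<close>

lemma antichain_weight_le:
  fixes p :: real
  assumes "finite S" "F \<subseteq> Pow S" "\<And>A B. A \<in> F \<Longrightarrow> B \<in> F \<Longrightarrow> A \<subseteq> B \<Longrightarrow> A = B"
    and p: "0 < p" "p < 1" and s: "0 < s" "real s ^ 2 \<le> card S * p * (1 - p)"
  shows "(\<Sum>A\<in>F. p ^ card A * (1 - p) ^ (card S - card A)) \<le> 2 / s"
proof -
  have "(\<Sum>A\<in>F. p ^ card A * (1 - p) ^ (card S - card A)) \<le> (\<Sum>A\<in>F. 2 / s * (1 / real (card S choose card A)))"
  proof (rule sum_mono)
    fix A assume "A \<in> F"
    then have c: "card A \<le> card S" using assms by (auto intro: card_mono)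
    then have "(card S choose card A) > 0" by simp
    with binomial_point_prob_le[OF p s c]
    show "p ^ card A * (1 - p) ^ (card S - card A) \<le> 2 / s * (1 / real (card S choose card A))"
      using s(1) by (simp add: field_simps)
  qed
  also have "\<dots> = 2 / s * (\<Sum>A\<in>F. 1 / real (card S choose card A))" by (simp only: sum_distrib_left)
  also have "\<dots> \<le> 2 / s * 1"
    using lym_inequality[OF assms(1-3)] s(1) by (intro mult_left_mono) auto
  finally show ?thesis by simp
qed

section \<open>Independent coin flips\<close>

definition coins :: "'a set \<Rightarrow> real \<Rightarrow> ('a \<Rightarrow> bool) pmf" where
  "coins I p = Pi_pmf I False (\<lambda>_. bernoulli_pmf p)"

lemma prob_pair_pmf:
  "measure_pmf.prob (pair_pmf M N) {xy. R (fst xy) (snd xy)}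
     = measure_pmf.expectation N (\<lambda>y. measure_pmf.prob M {x. R x y})"
proof -
  let ?X = "{yx. R (snd yx) (fst yx)}"
  have "measure_pmf.prob (pair_pmf M N) {xy. R (fst xy) (snd xy)} = measure_pmf.prob (pair_pmf N M) ?X"
    by (subst pair_commute_pmf) (simp add: case_prod_unfold vimage_def)
  moreover have "emeasure (measure_pmf (pair_pmf N M)) ?X = (\<integral>\<^sup>+y. ennreal (measure_pmf.prob M {x. R x y}) \<partial>measure_pmf N)"
  proof -
    have "emeasure (measure_pmf (bind_pmf M (\<lambda>x. return_pmf (y, x)))) ?X = ennreal (measure_pmf.prob M {x. R x y})" for y
      unfolding map_pmf_def[symmetric] by (simp add: vimage_def measure_pmf.emeasure_eq_measure)
    then show ?thesis unfolding pair_pmf_def by (subst emeasure_bind_pmf) simp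
  qed
  ultimately show ?thesis
    by (subst (asm) nn_integral_eq_integral)
       (auto simp: measure_pmf.emeasure_eq_measure intro!: integral_nonneg_AE measure_pmf.integrable_const_bound[where B=1])
qed

lemma expectation_le_const:
  fixes f :: "'a \<Rightarrow> real"
  assumes "\<And>x. x \<in> set_pmf M \<Longrightarrow> 0 \<le> f x" "\<And>x. x \<in> set_pmf M \<Longrightarrow> f x \<le> b"
  shows "measure_pmf.expectation M f \<le> b"
proof -
  have "integrable (measure_pmf M) f"
    using assms by (intro measure_pmf.integrable_const_bound[where B=b]) (auto simp: AE_measure_pmf_iff)
  then have "measure_pmf.expectation M f \<le> measure_pmf.expectation M (\<lambda>_. b)"
    using assms by (intro integral_mono_AE) (auto simp: AE_measure_pmf_iff)
  then show ?thesis by simp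
qed

lemma prob_pair_pmf_le:
  assumes "\<And>y. measure_pmf.prob M {x. R x y} \<le> b"
  shows "measure_pmf.prob (pair_pmf M N) {xy. R (fst xy) (snd xy)} \<le> b"
  unfolding prob_pair_pmf by (rule expectation_le_const) (use assms in auto)

lemma coins_split:
  assumes "finite I" "J \<subseteq> I"
  shows "coins I p = map_pmf (\<lambda>xy i. if i \<in> J then fst xy i else snd xy i) (pair_pmf (coins J p) (coins (I - J) p))"
proof -
  have "J \<union> (I - J) = I" using assms by auto
  then show ?thesis
    using Pi_pmf_union[of J "I - J" False "\<lambda>_. bernoulli_pmf p"] assms finite_subset[OF assms(2,1)]
    unfolding coins_def by (simp add: case_prod_unfold)
qed

lemma coins_reindex:
  assumes "finite S" "inj h"
  shows "coins S p = map_pmf (\<lambda>f. f \<circ> h) (coins (h ` S) p)"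
  unfolding coins_def using assms
  by (intro Pi_pmf_bij_betw) (auto simp: inj_image_mem_iff intro: inj_on_imp_bij_betw inj_on_subset)

text \<open>
  Conditioning on all flips except those at the images of \<open>S\<close> under \<open>h\<close>, which are resampled as flips
  indexed by \<open>S\<close> itself.  The event \<open>R\<close> depends on the other flips only, so the bound is required
  only where \<open>R\<close> holds and its probability appears as a factor.  This is what makes both products over
  independent rows and exclusion of exceptional environments possible.
\<close>

lemma prob_coins_condition_le:
  assumes I: "finite I" and h: "inj h" "h ` S \<subseteq> I" and b: "0 \<le> b"
    and QR: "\<And>f. Q f \<Longrightarrow> R f"
    and R: "\<And>f g. (\<And>e. e \<notin> h ` S \<Longrightarrow> f e = g e) \<Longrightarrow> R f \<Longrightarrow> R g"
    and bound: "\<And>g. R g \<Longrightarrow> measure_pmf.prob (coins S p) {x. Q (\<lambda>e. if e \<in> h ` S then x (inv_into UNIV h e) else g e)} \<le> b"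
  shows "measure_pmf.prob (coins I p) {f. Q f} \<le> b * measure_pmf.prob (coins I p) {f. R f}"
proof -
  let ?J = "h ` S"
  let ?mix = "\<lambda>f g e. if e \<in> ?J then f e else g e"
  have finS: "finite S" using finite_imageD[OF finite_subset[OF h(2) I] inj_on_subset[OF h(1) subset_UNIV]] .
  have split: "measure_pmf.prob (coins I p) {f. P f}
      = measure_pmf.expectation (coins (I - ?J) p) (\<lambda>g. measure_pmf.prob (coins ?J p) {f. P (?mix f g)})" for P
  proof -
    have "measure_pmf.prob (coins I p) {f. P f}
      = measure_pmf.prob (pair_pmf (coins ?J p) (coins (I - ?J) p)) {xy. P (?mix (fst xy) (snd xy))}"
      by (subst coins_split[OF I h(2)]) (simp add: vimage_def)
    also have "\<dots> = measure_pmf.expectation (coins (I - ?J) p) (\<lambda>g. measure_pmf.prob (coins ?J p) {f. P (?mix f g)})"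
      by (rule prob_pair_pmf)
    finally show ?thesis .
  qed
  have R': "R (?mix f g) = R g" for f g
  proof
    show "R g" if "R (?mix f g)" by (rule R[OF _ that]) simp
    show "R (?mix f g)" if "R g" by (rule R[OF _ that]) simp
  qed
  have int: "integrable (measure_pmf (coins (I - ?J) p)) (\<lambda>g. measure_pmf.prob (coins ?J p) {f. P (?mix f g)})" for P
    by (intro measure_pmf.integrable_const_bound[where B=1]) auto
  have pt: "measure_pmf.prob (coins ?J p) {f. Q (?mix f g)} \<le> b * measure_pmf.prob (coins ?J p) {f. R (?mix f g)}" for g
  proof (cases "R g")
    case True
    have "measure_pmf.prob (coins ?J p) {f. Q (?mix f g)} = measure_pmf.prob (coins S p) {x. Q (\<lambda>e. if e \<in> ?J then x (inv_into UNIV h e) else g e)}"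
    proof -
      have "?mix f g = (\<lambda>e. if e \<in> ?J then (f \<circ> h) (inv_into UNIV h e) else g e)" for f
        using h(1) by (auto simp: fun_eq_iff)
      then show ?thesis unfolding coins_reindex[OF finS h(1)] by (simp add: vimage_def)
    qed
    also have "\<dots> \<le> b" by (rule bound[OF True])
    finally show ?thesis unfolding R' using True by simp
  next
    case False
    have "\<not> Q (?mix f g)" for f
    proof
      assume "Q (?mix f g)"
      then have "R (?mix f g)" by (rule QR)
      with False show False unfolding R' by contradiction
    qed
    then have "{f. Q (?mix f g)} = {}" by blast
    then show ?thesis using b by simp
  qed
  have "measure_pmf.prob (coins I p) {f. Q f}
      \<le> measure_pmf.expectation (coins (I - ?J) p) (\<lambda>g. b * measure_pmf.prob (coins ?J p) {f. R (?mix f g)})"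
    unfolding split[of Q] by (intro integral_mono int pt integrable_mult_right)
  also have "\<dots> = b * measure_pmf.prob (coins I p) {f. R f}"
    unfolding split[of R] by (rule integral_mult_right_zero)
  finally show ?thesis .
qed

lemma prob_coins_condition:
  assumes "finite I" "inj h" "h ` S \<subseteq> I"
    and bound: "\<And>g. measure_pmf.prob (coins S p) {x. Q (\<lambda>e. if e \<in> h ` S then x (inv_into UNIV h e) else g e)} \<le> b"
  shows "measure_pmf.prob (coins I p) {f. Q f} \<le> b"
proof -
  have "0 \<le> b" using bound[of "\<lambda>_. False"] by (meson measure_nonneg order_trans)
  with assms show ?thesis
    using prob_coins_condition_le[of I h S b Q "\<lambda>_. True" p] by simp
qed

text \<open>
  The row of \<open>t\<close> consists of the flips at \<open>{t, s}\<close> with \<open>s \<in> S\<close>.  The event \<open>P f t\<close> may depend on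
  flips that belong to none of the rows, for instance through a vector chosen from them; given those flips, the
  rows are independent.
\<close>

lemma prob_independent_rows_le:
  fixes S T :: "'a set"
  assumes I: "finite I" and fT: "finite T" and disj: "T \<inter> S = {}" and b: "0 \<le> b"
    and cross: "\<And>t s. t \<in> T \<Longrightarrow> s \<in> S \<Longrightarrow> {t, s} \<in> I"
    and dep: "\<And>f g t x. (\<And>e. e \<notin> {{t, s} | t s. t \<in> T \<and> s \<in> S} \<Longrightarrow> f e = g e) \<Longrightarrow> P f t x \<Longrightarrow> P g t x"
    and bound: "\<And>f t. t \<in> T \<Longrightarrow> measure_pmf.prob (coins S p) {x. P f t x} \<le> b"
  shows "measure_pmf.prob (coins I p) {f. \<forall>t\<in>T. P f t (\<lambda>s. s \<in> S \<and> f {t, s})} \<le> b ^ card T"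
proof -
  let ?E = "\<lambda>T' f. \<forall>t\<in>T'. P f t (\<lambda>s. s \<in> S \<and> f {t, s})"
  have "measure_pmf.prob (coins I p) {f. ?E T' f} \<le> b ^ card T'" if "T' \<subseteq> T" for T'
    using finite_subset[OF that fT] that
  proof (induction T' rule: finite_induct)
    case empty
    then show ?case by simp
  next
    case (insert t T')
    let ?h = "\<lambda>s. {t, s}"
    have tS: "t \<in> T" "t \<notin> S" using insert.prems disj by auto
    have same: "P f t' x = P g t' x" if "\<And>e. e \<notin> ?h ` S \<Longrightarrow> f e = g e" for f g t' x
    proof -
      have "f e = g e" if "e \<notin> {{t, s} | t s. t \<in> T \<and> s \<in> S}" for e
        using that tS(1) by (intro \<open>\<And>e. e \<notin> ?h ` S \<Longrightarrow> f e = g e\<close>) blast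
      then show ?thesis by (intro iffI) (erule dep[rotated], simp)+
    qed
    have row: "f {t', s} = g {t', s}" if "\<And>e. e \<notin> ?h ` S \<Longrightarrow> f e = g e" "t' \<in> T'" "s \<in> S" for f g :: "'a set \<Rightarrow> bool" and t' s
    proof (rule that(1))
      have "t' \<noteq> t" "t' \<notin> S" using insert.hyps(2) insert.prems disj that(2) by auto
      then show "{t', s} \<notin> ?h ` S" by (auto simp: doubleton_eq_iff)
    qed
    have "measure_pmf.prob (coins I p) {f. ?E (insert t T') f} \<le> b * measure_pmf.prob (coins I p) {f. ?E T' f}"
    proof (rule prob_coins_condition_le[OF I, of ?h S])
      show "inj ?h" by (auto simp: inj_def doubleton_eq_iff)
      then have inv: "inv_into UNIV ?h {t, s} = s" for s by (rule inv_f_f)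
      show "?h ` S \<subseteq> I" using cross tS by auto
      fix f g :: "'a set \<Rightarrow> bool" assume ag: "\<And>e. e \<notin> ?h ` S \<Longrightarrow> f e = g e" and E: "?E T' f"
      show "?E T' g"
      proof
        fix t' assume t': "t' \<in> T'"
        have "(\<lambda>s. s \<in> S \<and> f {t', s}) = (\<lambda>s. s \<in> S \<and> g {t', s})"
          using row[where f=f and g=g, OF ag t'] by (auto simp: fun_eq_iff)
        moreover have "P f t' (\<lambda>s. s \<in> S \<and> f {t', s})" using E t' by (rule bspec)
        then have "P g t' (\<lambda>s. s \<in> S \<and> f {t', s})"
          using same[where f=f and g=g, OF ag] by (rule iffD1[rotated])
        ultimately show "P g t' (\<lambda>s. s \<in> S \<and> g {t', s})" by (simp only:)
      qed
    next
      fix g assume "?E T' g"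
      let ?f = "\<lambda>x e. if e \<in> ?h ` S then x (inv_into UNIV ?h e) else g e"
      have inv: "inv_into UNIV ?h {t, s} = s" for s by (rule inv_f_f) (auto simp: inj_def doubleton_eq_iff)
      have "measure_pmf.prob (coins S p) {x. ?E (insert t T') (?f x)}
        \<le> measure_pmf.prob (coins S p) {x. P g t (\<lambda>s. s \<in> S \<and> x s)}"
      proof (rule measure_pmf.finite_measure_mono)
        show "{x. ?E (insert t T') (?f x)} \<subseteq> {x. P g t (\<lambda>s. s \<in> S \<and> x s)}"
        proof safe
          fix x assume "?E (insert t T') (?f x)"
          then have "P (?f x) t (\<lambda>s. s \<in> S \<and> ?f x {t, s})" by blast
          moreover have "(\<lambda>s. s \<in> S \<and> ?f x {t, s}) = (\<lambda>s. s \<in> S \<and> x s)" by (auto simp: inv fun_eq_iff)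
          moreover have "P (?f x) t y = P g t y" for y by (rule same) simp
          ultimately show "P g t (\<lambda>s. s \<in> S \<and> x s)" by (simp only:)
        qed
      qed simp
      also have "\<dots> = measure_pmf.prob (coins S p) {x. P g t x}"
      proof (rule measure_prob_cong_0)
        have "?h ` S \<subseteq> I" "inj_on ?h S" using cross tS by (auto simp: inj_on_def doubleton_eq_iff)
        then have "finite S" using I by (meson finite_imageD finite_subset)
        then have 0: "pmf (coins S p) x = 0" if "(\<lambda>s. s \<in> S \<and> x s) \<noteq> x" for x
          using that unfolding coins_def by (intro pmf_Pi_outside) (auto simp: fun_eq_iff)
        fix x
        show "pmf (coins S p) x = 0" if "x \<in> {x. P g t (\<lambda>s. s \<in> S \<and> x s)} - {x. P g t x}"
        proof (rule 0)
          show "(\<lambda>s. s \<in> S \<and> x s) \<noteq> x" using that by (metis DiffD1 DiffD2 mem_Collect_eq)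
        qed
        show "pmf (coins S p) x = 0" if "x \<in> {x. P g t x} - {x. P g t (\<lambda>s. s \<in> S \<and> x s)}"
        proof (rule 0)
          show "(\<lambda>s. s \<in> S \<and> x s) \<noteq> x" using that by (metis DiffD1 DiffD2 mem_Collect_eq)
        qed
      qed
      also have "\<dots> \<le> b" by (rule bound[OF tS(1)])
      finally show "measure_pmf.prob (coins S p) {x. ?E (insert t T') (?f x)} \<le> b" .
    next
      show "?E T' f" if "?E (insert t T') f" for f using that by blast
    qed (rule b)
    also have "\<dots> \<le> b * b ^ card T'" using insert b by (intro mult_left_mono) auto
    finally show ?case using insert.hyps by simp
  qed
  then show ?thesis by blast
qed

lemma pmf_coins:
  assumes "finite I" "A \<subseteq> I" "0 \<le> p" "p \<le> 1"
  shows "pmf (coins I p) (\<lambda>i. i \<in> A) = p ^ card A * (1 - p) ^ (card I - card A)"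
proof -
  have fA: "finite A" using assms finite_subset by blast
  have "pmf (coins I p) (\<lambda>i. i \<in> A) = (\<Prod>i\<in>I. pmf (bernoulli_pmf p) (i \<in> A))"
    unfolding coins_def using assms by (subst pmf_Pi') auto
  also have "\<dots> = (\<Prod>i\<in>I. if i \<in> A then p else 1 - p)"
    using assms by (intro prod.cong) auto
  also have "\<dots> = p ^ card A * (1 - p) ^ card (I - A)"
    using assms by (subst prod.If_cases) (auto simp: Int_absorb1 Diff_eq)
  also have "card (I - A) = card I - card A" using assms fA by (simp add: card_Diff_subset)
  finally show ?thesis .
qed

lemma prob_coins_sum:
  assumes "finite I" "0 \<le> p" "p \<le> 1"
  shows "measure_pmf.prob (coins I p) {f. Q {i \<in> I. f i}}
           = (\<Sum>A\<in>{A. A \<subseteq> I \<and> Q A}. p ^ card A * (1 - p) ^ (card I - card A))"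
proof -
  let ?c = "\<lambda>A i. i \<in> A"
  have fin: "finite {A. A \<subseteq> I \<and> Q A}" using assms by simp
  have "measure_pmf.prob (coins I p) {f. Q {i \<in> I. f i}} = measure_pmf.prob (coins I p) (?c ` {A. A \<subseteq> I \<and> Q A})"
  proof (rule measure_prob_cong_0)
    fix f assume f: "f \<in> {f. Q {i \<in> I. f i}} - ?c ` {A. A \<subseteq> I \<and> Q A}"
    have "\<not> (\<forall>x. x \<notin> I \<longrightarrow> f x = False)"
    proof
      assume "\<forall>x. x \<notin> I \<longrightarrow> f x = False"
      then have "f = ?c {i \<in> I. f i}" by (auto simp: fun_eq_iff)
      with f show False by blast
    qed
    then show "pmf (coins I p) f = 0"
      unfolding coins_def using assms(1) by (intro pmf_Pi_outside) auto
  next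
    fix f assume f: "f \<in> ?c ` {A. A \<subseteq> I \<and> Q A} - {f. Q {i \<in> I. f i}}"
    then obtain A where A: "A \<subseteq> I" "Q A" "f = ?c A" by blast
    then have "{i \<in> I. f i} = A" by auto
    with f A show "pmf (coins I p) f = 0" by simp
  qed
  also have "\<dots> = (\<Sum>f\<in>?c ` {A. A \<subseteq> I \<and> Q A}. pmf (coins I p) f)"
    using fin by (intro measure_measure_pmf_finite) auto
  also have "\<dots> = (\<Sum>A\<in>{A. A \<subseteq> I \<and> Q A}. pmf (coins I p) (?c A))"
    by (subst sum.reindex) (auto simp: inj_on_def fun_eq_iff)
  also have "\<dots> = (\<Sum>A\<in>{A. A \<subseteq> I \<and> Q A}. p ^ card A * (1 - p) ^ (card I - card A))"
    using assms by (intro sum.cong) (auto simp: pmf_coins)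
  finally show ?thesis .
qed

section \<open>The Littlewood-Offord inequality\<close>

text \<open>
  For positive coefficients the sets with a prescribed sum form an antichain.
\<close>

lemma littlewood_offord_pos:
  fixes v :: "'a \<Rightarrow> real" and p a :: real
  assumes I: "finite I" and p: "0 < p" "p < 1"
    and v: "\<And>i. i \<in> I \<Longrightarrow> v i > 0" and s: "0 < s" "real s ^ 2 \<le> card I * p * (1 - p)"
  shows "measure_pmf.prob (coins I p) {f. (\<Sum>i\<in>I. v i * of_bool (f i)) = a} \<le> 2 / s"
proof -
  let ?Q = "\<lambda>A. (\<Sum>i\<in>A. v i) = a"
  have "(\<Sum>i\<in>I. v i * of_bool (f i)) = (\<Sum>i\<in>{i \<in> I. f i}. v i)" for f
    using I by (simp add: of_bool_def sum.inter_filter if_distrib[of "\<lambda>x. _ * x"] cong: if_cong)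
  then have "measure_pmf.prob (coins I p) {f. (\<Sum>i\<in>I. v i * of_bool (f i)) = a}
      = measure_pmf.prob (coins I p) {f. ?Q {i \<in> I. f i}}" by simp
  also have "\<dots> = (\<Sum>A\<in>{A. A \<subseteq> I \<and> ?Q A}. p ^ card A * (1 - p) ^ (card I - card A))"
    using p by (intro prob_coins_sum I) auto
  also have "\<dots> \<le> 2 / s"
  proof (rule antichain_weight_le[OF I _ _ p s])
    fix A B assume A: "A \<in> {A. A \<subseteq> I \<and> ?Q A}" and B: "B \<in> {A. A \<subseteq> I \<and> ?Q A}" and sub: "A \<subseteq> B"
    show "A = B"
    proof (rule ccontr)
      assume "A \<noteq> B"
      with sub obtain i where i: "i \<in> B" "i \<notin> A" by blast
      have fB: "finite B" using B I finite_subset by blast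
      have "sum v A < sum v B"
        using fB sub i B v by (intro sum_strict_mono2[of _ _ i]) (auto intro: less_imp_le)
      with A B show False by simp
    qed
  qed auto
  finally show ?thesis .
qed

text \<open>
  At least half of the nonzero coefficients have the same sign.  After conditioning on the other
  flips, and possibly a change of all signs, the coefficients are positive.
\<close>

lemma littlewood_offord:
  fixes v :: "'a \<Rightarrow> real" and p a :: real
  assumes I: "finite I" and p: "0 < p" "p \<le> 1 / 2"
    and s: "0 < s" "4 * real s ^ 2 \<le> card {i \<in> I. v i \<noteq> 0} * p"
  shows "measure_pmf.prob (coins I p) {f. (\<Sum>i\<in>I. v i * of_bool (f i)) = a} \<le> 2 / s"
proof -
  have main: "measure_pmf.prob (coins I p) {f. (\<Sum>i\<in>I. w i * of_bool (f i)) = a'} \<le> 2 / s"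
    if k: "2 * real s ^ 2 \<le> card {i \<in> I. w i > 0} * p" for w :: "'a \<Rightarrow> real" and a'
  proof (rule prob_coins_condition[OF I, of id "{i \<in> I. w i > 0}"])
    let ?J = "{i \<in> I. w i > 0}"
    fix g
    have s2: "real s ^ 2 \<le> card ?J * p * (1 - p)"
    proof -
      have "card ?J * p * (1 / 2) \<le> card ?J * p * (1 - p)" using p by (intro mult_left_mono) auto
      with k show ?thesis by simp
    qed
    have "(\<Sum>i\<in>I. w i * of_bool (if i \<in> ?J then f i else g i))
        = (\<Sum>i\<in>?J. w i * of_bool (f i)) + (\<Sum>i\<in>I - ?J. w i * of_bool (g i))" for f
    proof -
      have "(\<Sum>i\<in>I. w i * of_bool (if i \<in> ?J then f i else g i))
        = (\<Sum>i\<in>?J. w i * of_bool (if i \<in> ?J then f i else g i)) + (\<Sum>i\<in>I - ?J. w i * of_bool (if i \<in> ?J then f i else g i))"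
        by (subst sum.subset_diff[of ?J I]) (use I in auto)
      also have "(\<Sum>i\<in>?J. w i * of_bool (if i \<in> ?J then f i else g i)) = (\<Sum>i\<in>?J. w i * of_bool (f i))"
        by (rule sum.cong) auto
      also have "(\<Sum>i\<in>I - ?J. w i * of_bool (if i \<in> ?J then f i else g i)) = (\<Sum>i\<in>I - ?J. w i * of_bool (g i))"
        by (rule sum.cong) auto
      finally show ?thesis .
    qed
    then have "measure_pmf.prob (coins ?J p) {f. (\<Sum>i\<in>I. w i * of_bool (if i \<in> ?J then f i else g i)) = a'}
      = measure_pmf.prob (coins ?J p) {f. (\<Sum>i\<in>?J. w i * of_bool (f i)) = a' - (\<Sum>i\<in>I - ?J. w i * of_bool (g i))}"
      by (simp add: eq_diff_eq)
    also have "\<dots> \<le> 2 / s" using I p s(1) s2 by (intro littlewood_offord_pos) auto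
    finally show "measure_pmf.prob (coins ?J p) {f. (\<Sum>i\<in>I. w i * of_bool (if i \<in> id ` ?J then f (inv_into UNIV id i) else g i)) = a'} \<le> 2 / s"
      unfolding inv_id image_id id_apply .
  qed auto
  have "{i \<in> I. v i \<noteq> 0} = {i \<in> I. v i > 0} \<union> {i \<in> I. - v i > 0}" by auto
  moreover have "card ({i \<in> I. v i > 0} \<union> {i \<in> I. - v i > 0}) = card {i \<in> I. v i > 0} + card {i \<in> I. - v i > 0}"
    using I by (intro card_Un_disjoint) auto
  ultimately have "4 * real s ^ 2 \<le> card {i \<in> I. v i > 0} * p + card {i \<in> I. - v i > 0} * p"
    using s by (simp add: algebra_simps)
  then consider "2 * real s ^ 2 \<le> card {i \<in> I. v i > 0} * p" | "2 * real s ^ 2 \<le> card {i \<in> I. - v i > 0} * p"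
    by linarith
  then show ?thesis
  proof cases
    case 1
    then show ?thesis by (rule main)
  next
    case 2
    from main[OF this, of "- a"] show ?thesis by (simp add: sum_negf)
  qed
qed

section \<open>Linear equations over finite index sets\<close>

text \<open>
  A row space has dimension at most the number of columns.  Gaussian elimination on the columns gives
  a spanning set of rows without introducing bases.
\<close>

lemma determining_rows:
  fixes M :: "'r \<Rightarrow> 'c \<Rightarrow> real"
  assumes "finite S"
  shows "\<exists>R\<subseteq>T. finite R \<and> card R \<le> card S \<and>
    (\<forall>w. (\<forall>i\<in>R. (\<Sum>s\<in>S. M i s * w s) = 0) \<longrightarrow> (\<forall>i\<in>T. (\<Sum>s\<in>S. M i s * w s) = 0))"
  using assms
proof (induction S arbitrary: M rule: finite_psubset_induct)
  case (psubset S)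
  show ?case
  proof (cases "\<forall>i\<in>T. \<forall>s\<in>S. M i s = 0")
    case True
    then show ?thesis by (intro exI[of _ "{}"]) simp
  next
    case False
    then obtain i c where i: "i \<in> T" and c: "c \<in> S" and nz: "M i c \<noteq> 0" by blast
    \<comment> \<open>Row \<open>i\<close> is used to eliminate column \<open>c\<close> from all rows.\<close>
    define N where "N j s = M j s - M j c / M i c * M i s" for j s
    have red: "(\<Sum>s\<in>S - {c}. N j s * w s) = (\<Sum>s\<in>S. M j s * w s)" if "(\<Sum>s\<in>S. M i s * w s) = 0" for j w
    proof -
      have "(\<Sum>s\<in>S - {c}. N j s * w s) = (\<Sum>s\<in>S. N j s * w s)"
        using psubset.hyps c nz by (subst sum.remove[of S c]) (auto simp: N_def)
      also have "\<dots> = (\<Sum>s\<in>S. M j s * w s) - M j c / M i c * (\<Sum>s\<in>S. M i s * w s)"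
        unfolding N_def sum_distrib_left sum_subtractf[symmetric] by (simp add: algebra_simps)
      finally show ?thesis using that by simp
    qed
    have "S - {c} \<subset> S" using c by blast
    from psubset.IH[OF this, of N] obtain R where R: "R \<subseteq> T" "finite R" "card R \<le> card (S - {c})"
      "\<And>w. (\<forall>i\<in>R. (\<Sum>s\<in>S - {c}. N i s * w s) = 0) \<Longrightarrow> (\<forall>i\<in>T. (\<Sum>s\<in>S - {c}. N i s * w s) = 0)"
      by blast
    have "card (insert i R) \<le> Suc (card (S - {c}))" using R(2,3) by (simp add: card_insert_if)
    also have "\<dots> = card S" using psubset.hyps c by (rule card.remove[symmetric])
    finally have "card (insert i R) \<le> card S" .
    moreover have "\<forall>j\<in>T. (\<Sum>s\<in>S. M j s * w s) = 0" if w: "\<forall>j\<in>insert i R. (\<Sum>s\<in>S. M j s * w s) = 0" for w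
      using R(4)[of w] w red by simp
    ultimately show ?thesis using R(1,2) i by (intro exI[of _ "insert i R"]) blast
  qed
qed

lemma underdetermined_has_kernel:
  fixes M :: "'r \<Rightarrow> 'c \<Rightarrow> real"
  assumes "finite T" "finite S" "card T < card S"
  shows "\<exists>w. (\<exists>s\<in>S. w s \<noteq> 0) \<and> (\<forall>i\<in>T. (\<Sum>s\<in>S. M i s * w s) = 0)"
  using assms
proof (induction T arbitrary: S M rule: finite_induct)
  case empty
  then have "S \<noteq> {}" by auto
  then show ?case by (intro exI[of _ "\<lambda>_. 1"]) auto
next
  case (insert i T)
  show ?case
  proof (cases "\<forall>s\<in>S. M i s = 0")
    case True
    have "card T < card S" using insert by simp
    then show ?thesis using insert.IH[OF insert.prems(1), of M] True by auto
  next
    case False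
    then obtain c where c: "c \<in> S" and nz: "M i c \<noteq> 0" by blast
    define N where "N j s = M j s - M j c / M i c * M i s" for j s
    have "card T < card (S - {c})" using insert c by simp
    with insert.IH[of "S - {c}" N] insert.prems obtain w
      where w: "\<exists>s\<in>S - {c}. w s \<noteq> 0" "\<forall>j\<in>T. (\<Sum>s\<in>S - {c}. N j s * w s) = 0" by blast
    define u where "u = w(c := - (\<Sum>s\<in>S - {c}. M i s * w s) / M i c)"
    have u: "(\<Sum>s\<in>S. M j s * u s) = M j c * u c + (\<Sum>s\<in>S - {c}. M j s * w s)" for j
      using insert.prems c by (subst sum.remove[of S c]) (auto simp: u_def intro: sum.cong)
    have "(\<Sum>s\<in>S. M j s * u s) = 0" if "j \<in> insert i T" for j
    proof (cases "j = i")
      case True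
      then show ?thesis using nz by (simp add: u) (simp add: u_def)
    next
      case False
      then have "(\<Sum>s\<in>S - {c}. N j s * w s) = 0" using that w by blast
      moreover have "(\<Sum>s\<in>S - {c}. N j s * w s) = (\<Sum>s\<in>S - {c}. M j s * w s) - M j c / M i c * (\<Sum>s\<in>S - {c}. M i s * w s)"
        unfolding N_def sum_distrib_left sum_subtractf[symmetric] by (simp add: algebra_simps)
      ultimately show ?thesis by (simp add: u) (simp add: u_def)
    qed
    moreover have "\<exists>s\<in>S. u s \<noteq> 0" using w(1) by (auto simp: u_def)
    ultimately show ?thesis by blast
  qed
qed

text \<open>
  The right-hand side is adjoined as an additional column.  The enlarged system has more unknowns than
  equations, and injectivity forces the additional unknown of a nonzero solution to be nonzero.
\<close>

lemma square_system_solvable: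
  fixes M :: "'r \<Rightarrow> 'c \<Rightarrow> real"
  assumes fin: "finite T" "finite S" and card: "card T = card S"
    and inj: "\<And>w. (\<And>i. i \<in> T \<Longrightarrow> (\<Sum>s\<in>S. M i s * w s) = 0) \<Longrightarrow> (\<And>s. s \<in> S \<Longrightarrow> w s = 0)"
  shows "\<exists>w. \<forall>i\<in>T. (\<Sum>s\<in>S. M i s * w s) = b i"
proof -
  define M' where "M' i c = (case c of None \<Rightarrow> - b i | Some s \<Rightarrow> M i s)" for i c
  have "card T < card (insert None (Some ` S))"
    using fin card by (simp add: card_image)
  with underdetermined_has_kernel[of T "insert None (Some ` S)" M'] fin obtain u
    where u: "\<exists>c\<in>insert None (Some ` S). u c \<noteq> 0" "\<forall>i\<in>T. (\<Sum>c\<in>insert None (Some ` S). M' i c * u c) = 0"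
    by blast
  have eq: "(\<Sum>s\<in>S. M i s * u (Some s)) = u None * b i" if "i \<in> T" for i
  proof -
    have "(\<Sum>c\<in>insert None (Some ` S). M' i c * u c) = - b i * u None + (\<Sum>s\<in>S. M i s * u (Some s))"
      using fin by (subst sum.insert) (auto simp: M'_def sum.reindex)
    with u(2) that show ?thesis by (simp add: mult.commute)
  qed
  have "u None \<noteq> 0"
  proof
    assume 0: "u None = 0"
    then have "u (Some s) = 0" if "s \<in> S" for s using inj[of "\<lambda>s. u (Some s)"] eq that by simp
    with 0 u(1) show False by auto
  qed
  moreover have "(\<Sum>s\<in>S. M i s * (u (Some s) / u None)) = (\<Sum>s\<in>S. M i s * u (Some s)) / u None" for i
    by (simp add: sum_divide_distrib)
  ultimately show ?thesis using eq by (intro exI[of _ "\<lambda>s. u (Some s) / u None"]) simp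
qed

section \<open>Markov and Cauchy-Schwarz\<close>

text \<open>
  Markov's inequality for the number of events that occur.
\<close>

lemma prob_many_le:
  fixes t e :: real
  assumes J: "finite J" and t: "0 < t" and e: "\<And>j. j \<in> J \<Longrightarrow> measure_pmf.prob M {f. E j f} \<le> e"
  shows "measure_pmf.prob M {f. t \<le> real (card {j \<in> J. E j f})} \<le> card J * e / t"
proof -
  let ?I = "\<lambda>j. indicat_real {f. E j f}"
  have int: "integrable (measure_pmf M) (indicat_real A)" for A
    by (rule measure_pmf.integrable_const_bound[where B=1]) (simp_all add: indicator_def)
  have ints: "integrable (measure_pmf M) (\<lambda>f. \<Sum>j\<in>J. ?I j f)"
    by (rule Bochner_Integration.integrable_sum) (rule int)
  have cnt: "(\<Sum>j\<in>J. ?I j f) = real (card {j \<in> J. E j f})" for f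
  proof -
    have "real (card {j \<in> J. E j f}) = (\<Sum>j\<in>{j \<in> J. E j f}. 1)" by simp
    also have "\<dots> = (\<Sum>j\<in>J. ?I j f)"
      unfolding sum.inter_filter[OF J] by (intro sum.cong refl) (simp add: indicator_def)
    finally show ?thesis ..
  qed
  have "t * measure_pmf.prob M {f. t \<le> real (card {j \<in> J. E j f})}
     = measure_pmf.expectation M (\<lambda>f. t * indicat_real {f. t \<le> real (card {j \<in> J. E j f})} f)"
    unfolding integral_mult_right_zero by simp
  also have "\<dots> \<le> measure_pmf.expectation M (\<lambda>f. \<Sum>j\<in>J. ?I j f)"
  proof (rule integral_mono[OF integrable_mult_right[OF int] ints])
    show "t * indicat_real {f. t \<le> real (card {j \<in> J. E j f})} f \<le> (\<Sum>j\<in>J. ?I j f)" for f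
      unfolding cnt using t by (simp add: indicator_def)
  qed
  also have "\<dots> = (\<Sum>j\<in>J. measure_pmf.prob M {f. E j f})"
    by (subst Bochner_Integration.integral_sum[OF int]) simp
  also have "\<dots> \<le> card J * e"
    using sum_bounded_above[of J "\<lambda>j. measure_pmf.prob M {f. E j f}" e] e by simp
  finally show ?thesis using t by (simp add: field_simps)
qed

text \<open>
  Decoupling: the conditional probability given \<open>z\<close> has a square that is the probability for two
  independent copies of \<open>y\<close>, and the mean of the squares is at least the square of the mean.
\<close>

lemma prob_square_le:
  "(measure_pmf.prob (pair_pmf Y Z) {yz. E (fst yz) (snd yz)})\<^sup>2
     \<le> measure_pmf.prob (pair_pmf Z (pair_pmf Y Y)) {zy. E (fst (snd zy)) (fst zy) \<and> E (snd (snd zy)) (fst zy)}"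
proof -
  define g where "g z = measure_pmf.prob Y {y. E y z}" for z
  have g01: "0 \<le> g z" "g z \<le> 1" for z by (simp_all add: g_def)
  have int: "integrable (measure_pmf Z) g"
    by (rule measure_pmf.integrable_const_bound[where B=1]) (simp_all add: g01)
  have int2: "integrable (measure_pmf Z) (\<lambda>z. (g z)\<^sup>2)"
    by (rule measure_pmf.integrable_const_bound[where B=1]) (simp_all add: g01 power_le_one)
  have sq: "(g z)\<^sup>2 = measure_pmf.prob (pair_pmf Y Y) {yy. E (fst yy) z \<and> E (snd yy) z}" for z
  proof -
    have "measure_pmf.prob (pair_pmf Y Y) {yy. (\<lambda>y y'. E y z \<and> E y' z) (fst yy) (snd yy)}
        = measure_pmf.expectation Y (\<lambda>y'. measure_pmf.prob Y {y. E y z \<and> E y' z})"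
      by (rule prob_pair_pmf)
    also have "\<dots> = measure_pmf.expectation Y (\<lambda>y'. g z * indicat_real {y'. E y' z} y')"
      by (rule Bochner_Integration.integral_cong) (simp_all add: g_def indicator_def)
    also have "\<dots> = (g z)\<^sup>2"
      unfolding integral_mult_right_zero by (simp add: g_def power2_eq_square)
    finally show ?thesis ..
  qed
  have "measure_pmf.variance Z g = measure_pmf.expectation Z (\<lambda>z. (g z)\<^sup>2) - (measure_pmf.expectation Z g)\<^sup>2"
    by (rule measure_pmf.variance_eq[OF int int2])
  then have "(measure_pmf.expectation Z g)\<^sup>2 \<le> measure_pmf.expectation Z (\<lambda>z. (g z)\<^sup>2)"
    using measure_pmf.variance_positive[of Z g] by linarith
  also have "\<dots> = measure_pmf.prob (pair_pmf (pair_pmf Y Y) Z) {yyz. (\<lambda>yy z. E (fst yy) z \<and> E (snd yy) z) (fst yyz) (snd yyz)}"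
    unfolding sq by (rule prob_pair_pmf[symmetric])
  also have "\<dots> = measure_pmf.prob (pair_pmf Z (pair_pmf Y Y)) {zy. E (fst (snd zy)) (fst zy) \<and> E (snd (snd zy)) (fst zy)}"
    by (subst pair_commute_pmf) (simp add: case_prod_unfold vimage_def)
  finally show ?thesis unfolding prob_pair_pmf g_def .
qed

section \<open>The quadratic Littlewood-Offord inequality\<close>

lemma quadratic_form_split:
  fixes Q :: "'a \<Rightarrow> 'a \<Rightarrow> real"
  assumes fin: "finite U" "finite Z" and disj: "U \<inter> Z = {}"
    and sym: "\<And>i j. i \<in> U \<Longrightarrow> j \<in> Z \<Longrightarrow> Q i j = Q j i"
    and xa: "\<And>i. i \<in> U \<Longrightarrow> x i = a i" and xc: "\<And>i. i \<in> Z \<Longrightarrow> x i = c i"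
  shows "(\<Sum>i\<in>U \<union> Z. \<Sum>j\<in>U \<union> Z. Q i j * x i * x j)
    = (\<Sum>i\<in>U. \<Sum>j\<in>U. Q i j * a i * a j) + 2 * (\<Sum>j\<in>Z. (\<Sum>u\<in>U. Q j u * a u) * c j)
      + (\<Sum>i\<in>Z. \<Sum>j\<in>Z. Q i j * c i * c j)"
proof -
  have "(\<Sum>i\<in>U \<union> Z. \<Sum>j\<in>U \<union> Z. Q i j * x i * x j)
      = (\<Sum>i\<in>U. \<Sum>j\<in>U. Q i j * x i * x j) + (\<Sum>i\<in>U. \<Sum>j\<in>Z. Q i j * x i * x j)
        + ((\<Sum>i\<in>Z. \<Sum>j\<in>U. Q i j * x i * x j) + (\<Sum>i\<in>Z. \<Sum>j\<in>Z. Q i j * x i * x j))"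
    using fin disj by (simp add: sum.union_disjoint sum.distrib)
  also have "(\<Sum>i\<in>U. \<Sum>j\<in>U. Q i j * x i * x j) = (\<Sum>i\<in>U. \<Sum>j\<in>U. Q i j * a i * a j)"
    by (intro sum.cong refl) (simp add: xa)
  also have "(\<Sum>i\<in>U. \<Sum>j\<in>Z. Q i j * x i * x j) = (\<Sum>j\<in>Z. (\<Sum>u\<in>U. Q j u * a u) * c j)"
    by (subst sum.swap, intro sum.cong refl, simp only: sum_distrib_right, intro sum.cong refl)
       (simp add: xa xc sym)
  also have "(\<Sum>i\<in>Z. \<Sum>j\<in>U. Q i j * x i * x j) = (\<Sum>j\<in>Z. (\<Sum>u\<in>U. Q j u * a u) * c j)"
    by (intro sum.cong refl, simp only: sum_distrib_right, intro sum.cong refl) (simp add: xa xc)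
  also have "(\<Sum>i\<in>Z. \<Sum>j\<in>Z. Q i j * x i * x j) = (\<Sum>i\<in>Z. \<Sum>j\<in>Z. Q i j * c i * c j)"
    by (intro sum.cong refl) (simp add: xc)
  finally show ?thesis by simp
qed

text \<open>
  With \<open>x\<close> split into its part \<open>y\<close> on \<open>U\<close> and its part \<open>z\<close> on the complement, decoupling replaces the
  quadratic equation by its difference for two copies \<open>y\<close> and \<open>y'\<close>.  There the terms that are quadratic in \<open>z\<close>
  cancel, and a linear equation for \<open>z\<close> with coefficients \<open>L y y' j\<close> remains.  The linear inequality is
  then used twice: with respect to \<open>y\<close> each single coefficient with \<open>j \<in> G\<close> rarely vanishes, so at
  least half of them are nonzero with large probability; and with respect to \<open>z\<close> the
  equation is then improbable.  The square root undoes the squaring of the decoupling.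
\<close>

lemma quadratic_littlewood_offord:
  fixes Q :: "'a \<Rightarrow> 'a \<Rightarrow> real" and p d :: real
  assumes W: "finite W" and U: "U \<subseteq> W" and G: "G \<subseteq> W - U" and p: "0 < p" "p \<le> 1 / 2"
    and sym: "\<And>i j. i \<in> W \<Longrightarrow> j \<in> W \<Longrightarrow> Q i j = Q j i" and s: "0 < s"
    and rows: "\<And>j. j \<in> G \<Longrightarrow> 4 * real s ^ 2 \<le> card {u \<in> U. Q j u \<noteq> 0} * p"
    and many: "8 * real s ^ 2 \<le> card G * p"
  shows "measure_pmf.prob (coins W p)
      {x. (\<Sum>i\<in>W. \<Sum>j\<in>W. Q i j * of_bool (x i) * of_bool (x j)) = d} \<le> sqrt (6 / s)"
proof -
  define Z where "Z = W - U"
  have fin: "finite U" "finite Z" "finite G" and WUZ: "W = U \<union> Z" and disj: "U \<inter> Z = {}" and GZ: "G \<subseteq> Z"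
    using W U G finite_subset by (auto simp: Z_def intro: finite_subset)
  have Gpos: "0 < card G"
  proof (rule ccontr)
    assume "\<not> 0 < card G"
    with many s show False by simp
  qed
  define F where "F x = (\<Sum>i\<in>W. \<Sum>j\<in>W. Q i j * of_bool (x i) * of_bool (x j))" for x
  define E where "E y z \<longleftrightarrow> F (\<lambda>i. if i \<in> U then y i else z i) = d" for y z
  define L where "L y y' j = (\<Sum>u\<in>U. Q j u * of_bool (y u)) - (\<Sum>u\<in>U. Q j u * of_bool (y' u))" for y y' j
  define A where "A y = (\<Sum>i\<in>U. \<Sum>j\<in>U. Q i j * of_bool (y i) * of_bool (y j))" for y :: "'a \<Rightarrow> bool"
  define H where "H z = (\<Sum>i\<in>Z. \<Sum>j\<in>Z. Q i j * of_bool (z i) * of_bool (z j))" for z :: "'a \<Rightarrow> bool"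
  define B where "B yy \<longleftrightarrow> card G / 2 \<le> real (card {j \<in> G. L (fst yy) (snd yy) j = 0})" for yy
  let ?YY = "pair_pmf (coins U p) (coins U p)"
  have F_split: "F (\<lambda>i. if i \<in> U then y i else z i)
     = A y + 2 * (\<Sum>j\<in>Z. (\<Sum>u\<in>U. Q j u * of_bool (y u)) * of_bool (z j)) + H z" for y z
    unfolding F_def A_def H_def WUZ
    by (rule quadratic_form_split[OF fin(1,2) disj]) (use sym WUZ disj in auto)
  have diff: "(\<Sum>j\<in>Z. L y y' j * of_bool (z j)) = (A y' - A y) / 2" if "E y z" "E y' z" for y y' z
  proof -
    have "(\<Sum>j\<in>Z. L y y' j * of_bool (z j))
        = (\<Sum>j\<in>Z. (\<Sum>u\<in>U. Q j u * of_bool (y u)) * of_bool (z j)) - (\<Sum>j\<in>Z. (\<Sum>u\<in>U. Q j u * of_bool (y' u)) * of_bool (z j))"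
      unfolding L_def left_diff_distrib sum_subtractf ..
    with that show ?thesis unfolding E_def F_split by simp
  qed
  have "measure_pmf.prob (coins W p) {x. F x = d}
      = measure_pmf.prob (pair_pmf (coins U p) (coins Z p)) {yz. E (fst yz) (snd yz)}"
    unfolding coins_split[OF W U] Z_def E_def by (simp add: vimage_def)
  then have "(measure_pmf.prob (coins W p) {x. F x = d})\<^sup>2
     \<le> measure_pmf.prob (pair_pmf (coins Z p) ?YY) {zy. E (fst (snd zy)) (fst zy) \<and> E (snd (snd zy)) (fst zy)}"
    using prob_square_le[of "coins U p" "coins Z p" E] by simp
  also have "\<dots> \<le> measure_pmf.prob (pair_pmf (coins Z p) ?YY)
      ({zy. (\<lambda>z yy. \<not> B yy \<and> E (fst yy) z \<and> E (snd yy) z) (fst zy) (snd zy)} \<union> {zy. B (snd zy)})"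
    by (rule measure_pmf.finite_measure_mono) auto
  also have "\<dots> \<le> measure_pmf.prob (pair_pmf (coins Z p) ?YY) {zy. (\<lambda>z yy. \<not> B yy \<and> E (fst yy) z \<and> E (snd yy) z) (fst zy) (snd zy)}
      + measure_pmf.prob (pair_pmf (coins Z p) ?YY) {zy. B (snd zy)}"
    by (rule measure_Un_le) simp_all
  also have "\<dots> \<le> 2 / s + 4 / s"
  proof (rule add_mono)
    show "measure_pmf.prob (pair_pmf (coins Z p) ?YY)
       {zy. (\<lambda>z yy. \<not> B yy \<and> E (fst yy) z \<and> E (snd yy) z) (fst zy) (snd zy)} \<le> 2 / s"
    proof (rule prob_pair_pmf_le)
      fix yy
      show "measure_pmf.prob (coins Z p) {z. \<not> B yy \<and> E (fst yy) z \<and> E (snd yy) z} \<le> 2 / s"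
      proof (cases "B yy")
        case True
        then show ?thesis using s by simp
      next
        case False
        let ?L = "L (fst yy) (snd yy)"
        have "card G = card {j \<in> G. ?L j = 0} + card {j \<in> G. ?L j \<noteq> 0}"
          using fin by (subst card_Un_disjoint[symmetric]) (auto intro: arg_cong[where f=card])
        then have "card G / 2 \<le> card {j \<in> G. ?L j \<noteq> 0}" using False by (simp add: B_def)
        moreover have "card {j \<in> G. ?L j \<noteq> 0} \<le> card {j \<in> Z. ?L j \<noteq> 0}"
          using fin GZ by (intro card_mono) auto
        ultimately have "card G / 2 * p \<le> card {j \<in> Z. ?L j \<noteq> 0} * p" using p by (intro mult_right_mono) auto
        then have k: "4 * real s ^ 2 \<le> card {j \<in> Z. ?L j \<noteq> 0} * p" using many by simp
        have "measure_pmf.prob (coins Z p) {z. \<not> B yy \<and> E (fst yy) z \<and> E (snd yy) z}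
          \<le> measure_pmf.prob (coins Z p) {z. (\<Sum>j\<in>Z. ?L j * of_bool (z j)) = (A (snd yy) - A (fst yy)) / 2}"
          using diff by (intro measure_pmf.finite_measure_mono) auto
        also have "\<dots> \<le> 2 / s" by (rule littlewood_offord[OF fin(2) p s k])
        finally show ?thesis .
      qed
    qed
    have "measure_pmf.prob (pair_pmf (coins Z p) ?YY) {zy. B (snd zy)} = measure_pmf.prob (map_pmf snd (pair_pmf (coins Z p) ?YY)) {yy. B yy}"
      by (simp add: vimage_def)
    also have "\<dots> = measure_pmf.prob ?YY {yy. B yy}" by (simp only: map_snd_pair_pmf)
    also have "\<dots> \<le> card G * (2 / s) / (card G / 2)"
      unfolding B_def
    proof (rule prob_many_le[OF fin(3)])
      fix j assume j: "j \<in> G"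
      show "measure_pmf.prob ?YY {yy. L (fst yy) (snd yy) j = 0} \<le> 2 / s"
      proof (rule prob_pair_pmf_le[where R="\<lambda>y y'. L y y' j = 0"])
        fix y'
        show "measure_pmf.prob (coins U p) {y. L y y' j = 0} \<le> 2 / s"
          using littlewood_offord[OF fin(1) p s rows[OF j], of "\<Sum>u\<in>U. Q j u * of_bool (y' u)"]
          by (simp add: L_def)
      qed
    qed (use Gpos in simp)
    also have "\<dots> = 4 / s" using Gpos by simp
    finally show "measure_pmf.prob (pair_pmf (coins Z p) ?YY) {zy. B (snd zy)} \<le> 4 / s" .
  qed
  finally have "(measure_pmf.prob (coins W p) {x. F x = d})\<^sup>2 \<le> 6 / s" by simp
  then have "measure_pmf.prob (coins W p) {x. F x = d} \<le> sqrt (6 / s)" by (rule real_le_rsqrt)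
  then show ?thesis unfolding F_def .
qed

section \<open>Thin vectors\<close>

definition edge_slots :: "'a set \<Rightarrow> 'a set set" where
  "edge_slots V = {e. e \<subseteq> V \<and> card e = 2}"

text \<open>
  The diagonal entry \<open>f {i}\<close> vanishes for the random graph.  The linear algebra below is about arbitrary
  symmetric matrices, so that conditioning on arbitrary flips outside the set of pairs is harmless.
\<close>

definition adj :: "('a set \<Rightarrow> bool) \<Rightarrow> 'a \<Rightarrow> 'a \<Rightarrow> real" where
  "adj f i j = of_bool (f {i, j})"

text \<open>
  A vector with support \<open>S\<close> enters only through its restriction to \<open>S\<close>.
\<close>

definition null_on :: "('a set \<Rightarrow> bool) \<Rightarrow> 'a set \<Rightarrow> 'a set \<Rightarrow> bool" where
  "null_on f S T \<longleftrightarrow> (\<exists>q. (\<forall>u\<in>S. q u \<noteq> 0) \<and> (\<forall>t\<in>T. (\<Sum>u\<in>S. adj f t u * q u) = 0))"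

text \<open>
  \<open>T\<close> is the set of rows that annihilate the vector and \<open>U\<close> the set of columns that it may use.  The parameter \<open>n\<close>
  is kept apart from \<open>card U\<close> since it also serves for matrices with some rows and columns deleted.
\<close>

definition thin_null :: "('a set \<Rightarrow> bool) \<Rightarrow> nat \<Rightarrow> 'a set \<Rightarrow> 'a set \<Rightarrow> bool" where
  "thin_null f n U T \<longleftrightarrow> (\<exists>S\<subseteq>U. S \<noteq> {} \<and> 4 * card S \<le> n \<and> null_on f S T)"

lemma finite_edge_slots: "finite V \<Longrightarrow> finite (edge_slots V)"
  unfolding edge_slots_def by (rule finite_subset[of _ "Pow V"]) auto

lemma pair_in_edge_slots: "t \<in> V \<Longrightarrow> s \<in> V \<Longrightarrow> t \<noteq> s \<Longrightarrow> {t, s} \<in> edge_slots V"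
  by (simp add: edge_slots_def)

lemma prob_exactly_one:
  fixes p :: real
  assumes "finite S" "0 \<le> p" "p \<le> 1"
  shows "measure_pmf.prob (coins S p) {x. card {s \<in> S. x s} \<noteq> 1} = 1 - card S * p * (1 - p) ^ (card S - 1)"
proof -
  let ?N = "\<lambda>x. card {s \<in> S. x s}"
  have "measure_pmf.prob (coins S p) {x. ?N x = 1} = measure_pmf.prob (map_pmf ?N (coins S p)) {1}"
    by (simp add: vimage_def)
  also have "map_pmf ?N (coins S p) = binomial_pmf (card S) p"
    unfolding coins_def using assms by (intro binomial_pmf_altdef'[symmetric]) auto
  also have "measure_pmf.prob (binomial_pmf (card S) p) {1} = card S * p * (1 - p) ^ (card S - 1)"
    unfolding measure_pmf_single using assms by (subst pmf_binomial) simp_all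
  finally have one: "measure_pmf.prob (coins S p) {x. ?N x = 1} = card S * p * (1 - p) ^ (card S - 1)" .
  have "measure_pmf.prob (coins S p) {x. ?N x \<noteq> 1} = 1 - measure_pmf.prob (coins S p) {x. ?N x = 1}"
    by (subst measure_pmf.prob_compl[symmetric]) (auto intro: arg_cong[where f="measure_pmf.prob _"])
  then show ?thesis unfolding one .
qed

text \<open>
  A row with exactly one neighbour in \<open>S\<close> contributes a single nonzero term, so no row outside \<open>S\<close> may
  have this property.
\<close>

lemma prob_null_on_small:
  fixes p :: real
  assumes V: "finite V" and S: "S \<subseteq> V" "S \<noteq> {}" and T: "T \<subseteq> V" and p: "0 \<le> p" "p \<le> 1"
  shows "measure_pmf.prob (coins (edge_slots V) p) {f. null_on f S T}
    \<le> (1 - card S * p * (1 - p) ^ (card S - 1)) ^ card (T - S)"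
proof -
  let ?b = "1 - card S * p * (1 - p) ^ (card S - 1)"
  have fin: "finite S" "finite (T - S)"
    using finite_subset[OF S(1) V] finite_subset[OF T V] by auto
  have b: "0 \<le> ?b" unfolding prob_exactly_one[OF fin(1) p, symmetric] by (rule measure_nonneg)
  have "measure_pmf.prob (coins (edge_slots V) p) {f. null_on f S T}
     \<le> measure_pmf.prob (coins (edge_slots V) p) {f. \<forall>t\<in>T - S. (\<lambda>f t x. card {s \<in> S. x s} \<noteq> 1) f t (\<lambda>s. s \<in> S \<and> f {t, s})}"
  proof (rule measure_pmf.finite_measure_mono)
    show "{f. null_on f S T} \<subseteq> {f. \<forall>t\<in>T - S. (\<lambda>f t x. card {s \<in> S. x s} \<noteq> 1) f t (\<lambda>s. s \<in> S \<and> f {t, s})}"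
    proof safe
      fix f t assume "null_on f S T" and t: "t \<in> T" and one: "card {s \<in> S. s \<in> S \<and> f {t, s}} = 1"
      then obtain q where q: "\<And>u. u \<in> S \<Longrightarrow> q u \<noteq> 0" "(\<Sum>u\<in>S. adj f t u * q u) = 0"
        unfolding null_on_def by blast
      from one obtain w where w: "{s \<in> S. f {t, s}} = {w}" by (auto simp: card_1_singleton_iff)
      have "(\<Sum>u\<in>S. adj f t u * q u) = (\<Sum>u\<in>{s \<in> S. f {t, s}}. q u)"
        unfolding sum.inter_filter[OF fin(1)] adj_def by (intro sum.cong) auto
      also have "\<dots> = q w" unfolding w by simp
      finally have "q w = 0" using q(2) by simp
      moreover have "w \<in> S" using w by blast
      ultimately show False using q(1) by blast
    qed
  qed simp
  also have "\<dots> \<le> ?b ^ card (T - S)"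
  proof (rule prob_independent_rows_le[OF _ fin(2) _ b])
    show "finite (edge_slots V)" using V by (rule finite_edge_slots)
    show "{t, s} \<in> edge_slots V" if "t \<in> T - S" "s \<in> S" for t s
      using that S T by (intro pair_in_edge_slots) auto
    show "measure_pmf.prob (coins S p) {x. card {s \<in> S. x s} \<noteq> 1} \<le> ?b" for f :: "'a set \<Rightarrow> bool" and t :: 'a
      using prob_exactly_one[OF fin(1) p] by simp
    show "(T - S) \<inter> S = {}" by blast
  qed
  finally show ?thesis .
qed

text \<open>
  Union bound over the set \<open>R\<close> of determining rows.  Once the rows in \<open>R\<close> are fixed, choose a
  vector \<open>sel f R\<close> with full support that they annihilate.  Each of the remaining rows
  has to annihilate this particular vector, because \<open>R\<close> determines them, and the rows outside \<open>S\<close> do so independently.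
\<close>

lemma prob_null_on_large:
  fixes p :: real
  assumes V: "finite V" and S: "S \<subseteq> V" and T: "T \<subseteq> V" and p: "0 < p" "p \<le> 1 / 2"
    and s: "2 \<le> s" "4 * real s ^ 2 \<le> card S * p"
  shows "measure_pmf.prob (coins (edge_slots V) p) {f. null_on f S T}
    \<le> 2 ^ card V * (2 / s) ^ (card T - 2 * card S)"
proof -
  have fin: "finite S" "finite T" "finite (edge_slots V)"
    using S T V finite_subset finite_edge_slots by (auto intro: finite_subset)
  define full where "full q \<longleftrightarrow> (\<forall>u\<in>S. q u \<noteq> (0::real))" for q :: "'a \<Rightarrow> real"
  define kills where "kills f t q \<longleftrightarrow> (\<Sum>u\<in>S. adj f t u * q u) = 0" for f t q
  define cand where "cand f R q \<longleftrightarrow> full q \<and> (\<forall>t\<in>R. kills f t q)" for f R q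
  define sel where "sel f R = (SOME q. cand f R q)" for f R
  define ev where "ev R f \<longleftrightarrow> (\<forall>t\<in>T - S - R. cand f R (sel f R) \<and> kills f t (sel f R))" for R f
  define RR where "RR = {R. R \<subseteq> T - S \<and> card R \<le> card S}"
  have finRR: "finite RR" unfolding RR_def using fin by simp
  have "card RR \<le> card (Pow V)" using V T unfolding RR_def by (intro card_mono) auto
  then have cRR: "card RR \<le> 2 ^ card V" using V by (simp add: card_Pow)
  have "measure_pmf.prob (coins (edge_slots V) p) {f. null_on f S T}
     \<le> measure_pmf.prob (coins (edge_slots V) p) (\<Union>R\<in>RR. {f. ev R f})"
  proof (rule measure_pmf.finite_measure_mono)
    show "{f. null_on f S T} \<subseteq> (\<Union>R\<in>RR. {f. ev R f})"
    proof
      fix f assume "f \<in> {f. null_on f S T}"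
      then obtain q where q: "full q" "\<forall>t\<in>T. kills f t q"
        unfolding null_on_def full_def kills_def by blast
      obtain R where R: "R \<subseteq> T - S" "card R \<le> card S"
        and det: "\<And>w. \<forall>i\<in>R. kills f i w \<Longrightarrow> \<forall>i\<in>T - S. kills f i w"
        using determining_rows[OF fin(1), of "T - S" "adj f"] unfolding kills_def by blast
      have "cand f R q" using q R(1) unfolding cand_def by blast
      then have "cand f R (sel f R)" unfolding sel_def by (rule someI[of "cand f R"])
      moreover from this have "\<forall>i\<in>T - S. kills f i (sel f R)" by (intro det) (simp add: cand_def)
      ultimately have "ev R f" unfolding ev_def by blast
      with R show "f \<in> (\<Union>R\<in>RR. {f. ev R f})" unfolding RR_def by blast
    qed
  qed simp
  also have "\<dots> \<le> (\<Sum>R\<in>RR. measure_pmf.prob (coins (edge_slots V) p) {f. ev R f})"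
    by (rule measure_pmf.finite_measure_subadditive_finite[OF finRR]) simp
  also have "\<dots> \<le> (\<Sum>R\<in>RR. (2 / s) ^ (card T - 2 * card S))"
  proof (rule sum_mono)
    fix R assume R: "R \<in> RR"
    then have RT: "R \<subseteq> T - S" and cR: "card R \<le> card S" by (auto simp: RR_def)
    have b: "0 \<le> 2 / real s" "2 / real s \<le> 1" using s by auto
    define P where "P f t x \<longleftrightarrow> cand f R (sel f R) \<and> (\<Sum>u\<in>S. sel f R u * of_bool (x u)) = 0"
      for f and t :: 'a and x :: "'a \<Rightarrow> bool"
    have ev_eq: "ev R f \<longleftrightarrow> (\<forall>t\<in>T - S - R. P f t (\<lambda>s. s \<in> S \<and> f {t, s}))" for f
      unfolding ev_def P_def kills_def adj_def by (simp add: mult.commute cong: sum.cong)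
    have "measure_pmf.prob (coins (edge_slots V) p) {f. ev R f} \<le> (2 / s) ^ card (T - S - R)"
      unfolding ev_eq
    proof (rule prob_independent_rows_le[OF fin(3) _ _ b(1)])
      show "{t, s} \<in> edge_slots V" if "t \<in> T - S - R" "s \<in> S" for t s
        using that S T by (intro pair_in_edge_slots) auto
      show "P g t x" if ag: "\<And>e. e \<notin> {{t, s} | t s. t \<in> T - S - R \<and> s \<in> S} \<Longrightarrow> f e = g e" and Pf: "P f t x"
        for f g :: "'a set \<Rightarrow> bool" and t x
      proof -
        have "f {r, u} = g {r, u}" if "r \<in> R" "u \<in> S" for r u
        proof (rule ag)
          show "{r, u} \<notin> {{t, s} | t s. t \<in> T - S - R \<and> s \<in> S}"
            using that RT by (auto simp: doubleton_eq_iff)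
        qed
        then have "kills f r q \<longleftrightarrow> kills g r q" if "r \<in> R" for r q
          using that unfolding kills_def adj_def by (simp cong: sum.cong)
        then have "cand f R = cand g R" unfolding cand_def by (auto simp: fun_eq_iff)
        then show ?thesis using Pf unfolding P_def sel_def by simp
      qed
      show "measure_pmf.prob (coins S p) {x. P f t x} \<le> 2 / s" for f t
      proof (cases "cand f R (sel f R)")
        case True
        then have "{u \<in> S. sel f R u \<noteq> 0} = S" unfolding cand_def full_def by auto
        then show ?thesis
          unfolding P_def using True littlewood_offord[OF fin(1) p, of s "sel f R" 0] s by simp
      next
        case False
        then show ?thesis unfolding P_def by simp
      qed
    qed (use fin in auto)
    also have "\<dots> \<le> (2 / s) ^ (card T - 2 * card S)"
    proof (rule power_decreasing[OF _ b])
      have "card T - card S \<le> card (T - S)" using fin by (intro diff_card_le_card_Diff)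
      moreover have "card (T - S) - card R \<le> card (T - S - R)"
        using fin RT finite_subset by (intro diff_card_le_card_Diff) (auto intro: finite_subset)
      ultimately show "card T - 2 * card S \<le> card (T - S - R)" using cR by linarith
    qed
    finally show "measure_pmf.prob (coins (edge_slots V) p) {f. ev R f} \<le> (2 / s) ^ (card T - 2 * card S)" .
  qed
  also have "\<dots> = card RR * (2 / s) ^ (card T - 2 * card S)" by simp
  also have "\<dots> \<le> 2 ^ card V * (2 / s) ^ (card T - 2 * card S)"
    using of_nat_mono[OF cRR, where 'a=real] by (intro mult_right_mono) simp_all
  finally show ?thesis .
qed

text \<open>
  This evaluates the union bounds over supports without any estimates for binomial coefficients.
\<close>

lemma sum_power_card_subsets:
  fixes z :: real
  assumes "finite U"
  shows "(\<Sum>S\<in>Pow U. z ^ card S) = (1 + z) ^ card U"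
proof -
  have "(1 + z) ^ card U = (\<Prod>u\<in>U. z + 1)" by (simp add: add.commute)
  also have "\<dots> = (\<Sum>S\<in>Pow U. z ^ card S)"
    unfolding prod_add[OF assms] by simp
  finally show ?thesis ..
qed

text \<open>
  The union bound over supports with the numerical estimates left open.  In the bound for sets with
  \<open>k * p < K\<close>, the term \<open>y ^ k\<close> is meant for the tiny sets and \<open>B * x ^ k\<close> for the others; \<open>D\<close>
  is the bound for large sets, to which the choices of the support and of the determining rows contribute a factor
  \<open>2 ^ n\<close> each.
\<close>

lemma prob_thin_null_le:
  fixes p y x B D K :: real
  assumes V: "finite V" "card V = n" and U: "U \<subseteq> V" and T: "T \<subseteq> V" "n \<le> card T + 2"
    and p: "0 < p" "p \<le> 1 / 2" and nonneg: "0 \<le> y" "0 \<le> x" "0 \<le> B" "0 \<le> D"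
    and s: "2 \<le> s" "4 * real s ^ 2 \<le> K"
    and small: "\<And>k. 1 \<le> k \<Longrightarrow> 4 * k \<le> n \<Longrightarrow> k * p < K \<Longrightarrow> 0 \<le> 1 - k * p * (1 - p) ^ (k - 1)
       \<Longrightarrow> (1 - k * p * (1 - p) ^ (k - 1)) ^ (n - 2 - k) \<le> y ^ k + B * x ^ k"
    and large: "\<And>k. 4 * k \<le> n \<Longrightarrow> (2 / s) ^ (n - 2 - 2 * k) \<le> D"
  shows "measure_pmf.prob (coins (edge_slots V) p) {f. thin_null f n U T}
    \<le> ((1 + y) ^ n - 1) + B * (1 + x) ^ n + 2 ^ n * (2 ^ n * D)"
proof -
  let ?P = "measure_pmf.prob (coins (edge_slots V) p)"
  have finU: "finite U" using finite_subset[OF U V(1)] .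
  have finT: "finite T" using finite_subset[OF T(1) V(1)] .
  have cU: "card U \<le> n" using card_mono[OF V(1) U] V(2) by simp
  define SS where "SS = {S. S \<subseteq> U \<and> S \<noteq> {} \<and> 4 * card S \<le> n}"
  have SS: "SS \<subseteq> Pow U - {{}}" unfolding SS_def by blast
  have finSS: "finite SS" by (rule finite_subset[OF SS]) (use finU in simp)
  have each: "?P {f. null_on f S T} \<le> y ^ card S + B * x ^ card S + 2 ^ n * D" if S: "S \<in> SS" for S
  proof -
    let ?k = "card S"
    have SU: "S \<subseteq> U" "S \<noteq> {}" "4 * ?k \<le> n" using S by (auto simp: SS_def)
    have SV: "S \<subseteq> V" using SU U by blast
    have finS: "finite S" using finite_subset[OF SU(1) finU] .
    have k1: "1 \<le> ?k" using finS SU(2) by (simp add: Suc_leI card_gt_0_iff)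
    have D0: "0 \<le> 2 ^ n * D" using nonneg by simp
    have xy0: "0 \<le> y ^ ?k + B * x ^ ?k" using nonneg by simp
    show ?thesis
    proof (cases "?k * p < K")
      case True
      let ?b = "1 - ?k * p * (1 - p) ^ (?k - 1)"
      have b0: "0 \<le> ?b"
      proof -
        have "?b = measure_pmf.prob (coins S p) {x. card {s \<in> S. x s} \<noteq> 1}"
          using p by (intro prob_exactly_one[symmetric] finS) auto
        also have "\<dots> \<ge> 0" by (rule measure_nonneg)
        finally show ?thesis .
      qed
      have b1: "?b \<le> 1" using p by simp
      have "card T - ?k \<le> card (T - S)" using finS by (rule diff_card_le_card_Diff)
      then have "n - 2 - ?k \<le> card (T - S)" using T(2) by linarith
      then have "?b ^ card (T - S) \<le> ?b ^ (n - 2 - ?k)" by (rule power_decreasing[OF _ b0 b1])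
      moreover have "?P {f. null_on f S T} \<le> ?b ^ card (T - S)"
        using p by (intro prob_null_on_small V SV SU T) auto
      moreover have "?b ^ (n - 2 - ?k) \<le> y ^ ?k + B * x ^ ?k" by (rule small[OF k1 SU(3) True b0])
      ultimately show ?thesis using D0 by linarith
    next
      case False
      then have "4 * real s ^ 2 \<le> ?k * p" using s by linarith
      then have "?P {f. null_on f S T} \<le> 2 ^ card V * (2 / s) ^ (card T - 2 * ?k)"
        by (intro prob_null_on_large V SV T p s)
      also have "\<dots> \<le> 2 ^ n * (2 / s) ^ (n - 2 - 2 * ?k)"
        unfolding V(2) using s T(2) by (intro mult_left_mono power_decreasing) auto
      also have "\<dots> \<le> 2 ^ n * D" using large[OF SU(3)] by (intro mult_left_mono) auto
      finally show ?thesis using xy0 by linarith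
    qed
  qed
  have "?P {f. thin_null f n U T} \<le> ?P (\<Union>S\<in>SS. {f. null_on f S T})"
    by (rule measure_pmf.finite_measure_mono) (auto simp: thin_null_def SS_def)
  also have "\<dots> \<le> (\<Sum>S\<in>SS. ?P {f. null_on f S T})"
    by (rule measure_pmf.finite_measure_subadditive_finite[OF finSS]) simp
  also have "\<dots> \<le> (\<Sum>S\<in>SS. y ^ card S + B * x ^ card S + 2 ^ n * D)"
    by (rule sum_mono) (rule each)
  also have "\<dots> \<le> (\<Sum>S\<in>Pow U - {{}}. y ^ card S + B * x ^ card S + 2 ^ n * D)"
    using SS finU nonneg by (intro sum_mono2) auto
  also have "\<dots> = (\<Sum>S\<in>Pow U - {{}}. y ^ card S) + B * (\<Sum>S\<in>Pow U - {{}}. x ^ card S) + (\<Sum>S\<in>Pow U - {{}}. 2 ^ n * D)"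
    by (simp only: sum.distrib sum_distrib_left)
  also have "\<dots> \<le> ((1 + y) ^ n - 1) + B * (1 + x) ^ n + 2 ^ n * (2 ^ n * D)"
  proof (intro add_mono mult_left_mono nonneg)
    have minus: "(\<Sum>S\<in>Pow U - {{}}. z ^ card S) = (1 + z) ^ card U - 1" for z :: real
      using finU by (subst sum_diff1) (simp_all add: sum_power_card_subsets)
    have mono: "(1 + z) ^ card U \<le> (1 + z) ^ n" if "0 \<le> z" for z :: real
      using that cU by (intro power_increasing) auto
    show "(\<Sum>S\<in>Pow U - {{}}. y ^ card S) \<le> (1 + y) ^ n - 1" using minus mono nonneg by simp
    show "(\<Sum>S\<in>Pow U - {{}}. x ^ card S) \<le> (1 + x) ^ n" using minus[of x] mono[of x] nonneg by simp
    have "card (Pow U - {{}}) \<le> card (Pow U)" using finU by (intro card_mono) auto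
    also have "\<dots> \<le> 2 ^ n" using finU cU by (simp add: card_Pow)
    finally have "real (card (Pow U - {{}})) \<le> real (2 ^ n)" by (rule of_nat_mono)
    then have "real (card (Pow U - {{}})) * (2 ^ n * D) \<le> 2 ^ n * (2 ^ n * D)"
      using nonneg(4) by (intro mult_right_mono) simp_all
    then show "(\<Sum>S\<in>Pow U - {{}}. 2 ^ n * D) \<le> 2 ^ n * (2 ^ n * D)"
      by (simp only: sum_constant)
  qed
  finally show ?thesis .
qed

lemma power_le_exp_neg:
  fixes b :: real
  assumes "0 \<le> 1 - b" shows "(1 - b) ^ m \<le> exp (- b * m)"
proof -
  have "1 - b \<le> exp (- b)" using exp_ge_add_one_self[of "- b"] by simp
  then have "(1 - b) ^ m \<le> exp (- b) ^ m" using assms by (intro power_mono) auto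
  also have "\<dots> = exp (- b * m)" by (metis exp_of_nat_mult mult.commute)
  finally show ?thesis .
qed

text \<open>
  If \<open>k * p\<close> is below \<open>1 - r\<close>, then a row has exactly one neighbour in a set of size \<open>k\<close>
  with probability at least \<open>k * p * r\<close>, by Bernoulli's inequality.
\<close>

lemma unique_neighbour_failure_tiny_set:
  fixes p r c :: real and n m k :: nat
  assumes p: "0 < p" "p \<le> 1 / 2" and r: "0 < r" "r < 1" and k: "1 \<le> k" "k * p < 1 - r"
    and np: "c * ln n \<le> n * p" and m: "r * n \<le> real m" and nonneg: "0 \<le> 1 - k * p * (1 - p) ^ (k - 1)"
  shows "(1 - k * p * (1 - p) ^ (k - 1)) ^ m \<le> exp (- (c * r\<^sup>2 * ln n)) ^ k"
proof -
  let ?b = "k * p * (1 - p) ^ (k - 1)"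
  have "r \<le> 1 - k * p" using k by simp
  also have "\<dots> \<le> 1 + real (k - 1) * (- p)" using k p by (simp add: of_nat_diff algebra_simps)
  also have "\<dots> \<le> (1 + - p) ^ (k - 1)" using p by (intro Bernoulli_inequality) simp
  finally have "k * p * r \<le> ?b" using p by (intro mult_left_mono) auto
  then have "(k * p * r) * (r * n) \<le> ?b * m"
    by (rule mult_mono) (use m p r in auto)
  moreover have "k * (c * ln n) * r\<^sup>2 \<le> k * (n * p) * r\<^sup>2" using np by (intro mult_right_mono mult_left_mono) auto
  ultimately have "k * (c * r\<^sup>2 * ln n) \<le> ?b * m" by (simp add: power2_eq_square mult_ac)
  then have "exp (- ?b * m) \<le> exp (k * (- (c * r\<^sup>2 * ln n)))" by simp
  also have "\<dots> = exp (- (c * r\<^sup>2 * ln n)) ^ k" by (rule exp_of_nat_mult)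
  finally show ?thesis using power_le_exp_neg[OF nonneg, of m] by linarith
qed

text \<open>
  Here \<open>1 - p \<ge> exp (- 2 * p)\<close> shows that the probability of exactly one neighbour is at least
  the constant \<open>h * exp (- 2 * K)\<close>.
\<close>

lemma unique_neighbour_failure_small_set:
  fixes p h K :: real and n m k :: nat
  assumes p: "0 < p" "p \<le> 1 / 2" and h: "0 < h" "h \<le> k * p" and K: "k * p < K" and k: "1 \<le> k"
    and m: "n / 2 \<le> real m" and nonneg: "0 \<le> 1 - k * p * (1 - p) ^ (k - 1)"
  shows "(1 - k * p * (1 - p) ^ (k - 1)) ^ m \<le> exp (- (h * exp (- 2 * K) * n / 2))"
proof -
  let ?b = "k * p * (1 - p) ^ (k - 1)"
  have "exp (- 2 * K) \<le> exp (real (k - 1) * (- 2 * p))"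
  proof -
    have "real (k - 1) * p \<le> k * p" using p by (intro mult_right_mono) auto
    then have "- 2 * K \<le> real (k - 1) * (- 2 * p)" using K by (simp add: mult_ac)
    then show ?thesis by simp
  qed
  also have "\<dots> = exp (- 2 * p) ^ (k - 1)" by (rule exp_of_nat_mult)
  also have "\<dots> \<le> (1 - p) ^ (k - 1)"
  proof (rule power_mono)
    have "- p - 2 * p\<^sup>2 \<le> ln (1 - p)" using p by (intro ln_one_minus_pos_lower_bound) auto
    moreover have "2 * p\<^sup>2 \<le> p" using p by (simp add: power2_eq_square)
    ultimately have "- 2 * p \<le> ln (1 - p)" by linarith
    then have "exp (- 2 * p) \<le> exp (ln (1 - p))" by simp
    then show "exp (- 2 * p) \<le> 1 - p" using p by simp
  qed simp
  finally have hb: "h * exp (- 2 * K) \<le> ?b" using h by (intro mult_mono[OF h(2)]) auto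
  have "0 \<le> h * exp (- 2 * K)" using h by simp
  then have "0 \<le> ?b" using hb by linarith
  then have "h * exp (- 2 * K) * (n / 2) \<le> ?b * m" by (intro mult_mono[OF hb m]) auto
  then have "exp (- ?b * m) \<le> exp (- (h * exp (- 2 * K) * n / 2))" by simp
  then show ?thesis using power_le_exp_neg[OF nonneg, of m] by linarith
qed

text \<open>
  The constants: \<open>r < 1\<close> is such that \<open>d = c * r\<^sup>2\<close> still exceeds 1, the sets are tiny if
  \<open>k * p < h = 1 - r\<close>, and \<open>s\<close> makes the Littlewood-Offord bound \<open>2 / s\<close> equal to \<open>1/64\<close>.  For sets with
  \<open>h \<le> k * p < K\<close> the failure probability is at most \<open>exp (- b * n / 2)\<close>.  As \<open>k \<le> K * n / ln n\<close>, it may be multiplied by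
  \<open>x ^ k\<close> at the price of a factor \<open>exp (K * n / ln n * ln (1 / x))\<close>; the sum over all supports then
  gives \<open>(1 + x) ^ n \<le> exp (x * n)\<close>, and \<open>x = b / 4\<close> leaves \<open>exp (- b * n / 4)\<close> as the main term.
\<close>

lemma thin_null_unlikely:
  fixes c e :: real
  assumes c: "c > 1" and e: "e > 0"
  shows "eventually (\<lambda>n. \<forall>(V :: 'a set) U T p. finite V \<longrightarrow> card V = n \<longrightarrow> U \<subseteq> V \<longrightarrow> T \<subseteq> V \<longrightarrow> n \<le> card T + 2
     \<longrightarrow> c * ln n / n < p \<longrightarrow> p \<le> 1 / 2
     \<longrightarrow> measure_pmf.prob (coins (edge_slots V) p) {f. thin_null f n U T} \<le> e) sequentially"
proof -
  \<comment> \<open>Obtained instead of written out, to keep the numeral from being evaluated in powers.\<close>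
  obtain s :: nat where s: "s = 128" by blast
  define K where "K = 4 * real s ^ 2"
  define r where "r = 1 / sqrt (sqrt c)"
  define h where "h = 1 - r"
  define d where "d = c * r\<^sup>2"
  define b where "b = h * exp (- 2 * K)"
  define x where "x = b / 4"
  define l where "l = ln (1 / x)"
  have r: "0 < r" "r < 1" using c by (auto simp: r_def)
  have h: "0 < h" "h < 1" using r by (auto simp: h_def)
  have K: "0 < K" by (simp add: K_def s)
  have d: "1 < d"
  proof -
    have "r\<^sup>2 = 1 / sqrt c" using c by (simp add: r_def power_divide)
    then have "d = sqrt c" using c by (simp add: d_def real_div_sqrt)
    then show ?thesis using c by simp
  qed
  have b: "0 < b" "b < 1"
  proof -
    show "0 < b" using h by (simp add: b_def)
    have "exp (- 2 * K) \<le> 1" using K by simp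
    then have "b \<le> h * 1" unfolding b_def using h by (intro mult_left_mono) auto
    then show "b < 1" using h by simp
  qed
  have x: "0 < x" "x < 1" using b by (auto simp: x_def)
  have l: "0 < l" using x by (simp add: l_def)
  define err where "err n = (exp (n * exp (- (d * ln n))) - 1) + exp (K * n / ln n * l - b * n / 2 + x * n) + 4096 / 2 ^ n" for n :: nat
  have lim: "err \<longlonglongrightarrow> 0"
  proof -
    have 1: "(\<lambda>n::nat. exp (n * exp (- (d * ln n))) - 1) \<longlonglongrightarrow> 0" using d by real_asymp
    have 2: "(\<lambda>n::nat. exp (K * n / ln n * l - b * n / 4)) \<longlonglongrightarrow> 0" using b by real_asymp
    have 3: "(\<lambda>n::nat. 4096 / 2 ^ n :: real) \<longlonglongrightarrow> 0" by real_asymp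
    have eq: "K * n / ln n * l - b * n / 2 + x * n = K * n / ln n * l - b * n / 4" for n :: nat
      by (simp add: x_def)
    then show ?thesis using tendsto_add[OF tendsto_add[OF 1 2] 3] unfolding err_def eq by simp
  qed
  have "eventually (\<lambda>n. err n < e) sequentially" using order_tendstoD(2)[OF lim e] .
  moreover have "eventually (\<lambda>n::nat. h * (n / ln n) + 2 \<le> h * n) sequentially" using h by real_asymp
  moreover have "eventually (\<lambda>n::nat. K * (n / ln n) + 2 \<le> n / 2) sequentially" using K by real_asymp
  moreover have "eventually (\<lambda>n::nat. 1 \<le> ln n) sequentially" by real_asymp
  ultimately show ?thesis
  proof eventually_elim
    case (elim n)
    have n0: "0 < n" using elim(4) by (cases n) auto
    have lnpos: "0 < ln n" using elim(4) by simp
    show ?case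
    proof (intro allI impI)
      fix V :: "'a set" and U T p
      assume V: "finite V" "card V = n" and UT: "U \<subseteq> V" "T \<subseteq> V" "n \<le> card T + 2" and cp: "c * ln n / n < p" and p2: "p \<le> 1 / 2"
      have p0: "0 < p"
      proof -
        have "0 \<le> c * ln n / n" using c lnpos by simp
        with cp show ?thesis by linarith
      qed
      have np: "c * ln n \<le> n * p" using cp n0 by (simp add: field_simps)
      then have np1: "ln n \<le> n * p" by (rule order_trans[rotated]) (use c lnpos in simp)
      \<comment> \<open>From \<open>n * p \<ge> ln n\<close>: a bound on \<open>k * p\<close> makes \<open>k\<close> smaller than \<open>n\<close> by a factor \<open>ln n\<close>.\<close>
      have size: "real k \<le> a * (n / ln n)" if "k * p \<le> a" for k a
      proof -
        have "k * ln n \<le> k * (n * p)" using np1 by (intro mult_left_mono) auto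
        also have "\<dots> \<le> a * n" using mult_right_mono[OF that, of n] by (simp add: mult_ac)
        finally show ?thesis using lnpos by (simp add: field_simps)
      qed
      define y where "y = exp (- (d * ln n))"
      define B where "B = exp (K * n / ln n * l - b * n / 2)"
      have "measure_pmf.prob (coins (edge_slots V) p) {f. thin_null f n U T}
        \<le> ((1 + y) ^ n - 1) + B * (1 + x) ^ n + 2 ^ n * (2 ^ n * (4096 / 8 ^ n))"
      proof (rule prob_thin_null_le[OF V UT p0 p2])
        show "0 \<le> y" "0 \<le> x" "0 \<le> B" "0 \<le> 4096 / (8::real) ^ n" "2 \<le> s" "4 * real s ^ 2 \<le> K"
          using x by (auto simp: y_def B_def K_def s)
      next
        fix k :: nat assume k: "1 \<le> k" "k * p < K" and nonneg: "0 \<le> 1 - k * p * (1 - p) ^ (k - 1)"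
        have yk: "0 \<le> y ^ k" and Bk: "0 \<le> B * x ^ k" using x by (auto simp: y_def B_def)
        show "(1 - k * p * (1 - p) ^ (k - 1)) ^ (n - 2 - k) \<le> y ^ k + B * x ^ k"
        proof (cases "k * p < h")
          case True
          have "real k + 2 \<le> h * n" using size[of k h] True elim(2) by linarith
          then have "r * n \<le> real (n - 2 - k)" by (simp add: h_def algebra_simps)
          then have "(1 - k * p * (1 - p) ^ (k - 1)) ^ (n - 2 - k) \<le> y ^ k"
            unfolding y_def d_def using True h_def
            by (intro unique_neighbour_failure_tiny_set[OF p0 p2 r k(1) _ np _ nonneg]) auto
          then show ?thesis using Bk by linarith
        next
          case False
          have kK: "real k \<le> K * (n / ln n)" using size[of k K] k by simp
          then have "real k + 2 \<le> n / 2" using elim(3) by linarith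
          then have m: "n / 2 \<le> real (n - 2 - k)" by simp
          have "(1 - k * p * (1 - p) ^ (k - 1)) ^ (n - 2 - k) \<le> exp (- (b * n / 2))"
            unfolding b_def using False h by (intro unique_neighbour_failure_small_set[OF p0 p2 _ _ k(2,1) m nonneg]) auto
          also have "\<dots> \<le> exp (K * n / ln n * l - b * n / 2 - k * l)"
          proof -
            have "k * l \<le> K * (n / ln n) * l" using kK l by (intro mult_right_mono) auto
            then show ?thesis by simp
          qed
          also have "\<dots> = B * x ^ k"
          proof -
            have "exp (- (k * l)) = x ^ k"
            proof -
              have "- l = ln x" using x by (simp add: l_def ln_div)
              then have "exp (- (k * l)) = exp (k * ln x)" by (metis mult_minus_right)
              also have "\<dots> = x ^ k" using x by (simp add: exp_of_nat_mult)
              finally show ?thesis .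
            qed
            then show ?thesis
              unfolding B_def by (simp only: diff_conv_add_uminus exp_add)
          qed
          finally show ?thesis using yk by linarith
        qed
      next
        fix k :: nat assume k: "4 * k \<le> n"
        \<comment> \<open>Two rows are ignored and \<open>2 * k \<le> n / 2\<close> rows are lost to \<open>S\<close> and the determining rows.\<close>
        define m where "m = n - 2 - 2 * k"
        have "n \<le> 2 * m + 4" using k unfolding m_def by linarith
        then have "(1 / 8 :: real) ^ (2 * m + 4) \<le> (1 / 8) ^ n" by (intro power_decreasing) auto
        moreover have "(1 / 8 :: real) ^ (2 * m + 4) = (1 / 64) ^ m / 4096"
          by (simp add: power_add power_mult power2_eq_square power4_eq_xxxx)
        ultimately have "(1 / 64 :: real) ^ m \<le> 4096 * (1 / 8) ^ n" by linarith
        moreover have "2 / real s = 1 / 64" by (simp add: s)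
        ultimately show "(2 / real s) ^ (n - 2 - 2 * k) \<le> 4096 / 8 ^ n"
          unfolding m_def[symmetric] by (simp add: power_one_over)
      qed
      also have "\<dots> \<le> err n"
        unfolding err_def
      proof (intro add_mono)
        have "(1 + y) ^ n \<le> exp y ^ n" using exp_ge_add_one_self[of y] by (intro power_mono) (auto simp: y_def)
        also have "\<dots> = exp (n * y)" by (rule exp_of_nat_mult[symmetric])
        finally show "(1 + y) ^ n - 1 \<le> exp (n * exp (- (d * ln n))) - 1" by (simp add: y_def)
        have "(1 + x) ^ n \<le> exp x ^ n" using exp_ge_add_one_self[of x] x by (intro power_mono) auto
        also have "\<dots> = exp (n * x)" by (rule exp_of_nat_mult[symmetric])
        finally have "B * (1 + x) ^ n \<le> B * exp (n * x)" by (intro mult_left_mono) (auto simp: B_def)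
        then show "B * (1 + x) ^ n \<le> exp (K * n / ln n * l - b * n / 2 + x * n)"
          unfolding B_def exp_add mult.commute[of x] .
        have "(8::real) ^ n = 2 ^ n * 2 ^ n * 2 ^ n" by (simp flip: power_mult_distrib)
        then show "2 ^ n * (2 ^ n * (4096 / 8 ^ n)) \<le> 4096 / (2::real) ^ n" by simp
      qed
      finally show "measure_pmf.prob (coins (edge_slots V) p) {f. thin_null f n U T} \<le> e" using elim(1) by linarith
    qed
  qed
qed

section \<open>Bordered symmetric matrices\<close>

text \<open>
  Pairing the equation \<open>a v + c b = 0\<close> with \<open>u\<close> removes the first term, as \<open>a\<close> is symmetric.
\<close>

lemma border_orthogonal_to_kernel:
  fixes a :: "'a \<Rightarrow> 'a \<Rightarrow> real"
  assumes sym: "\<And>k j. a k j = a j k"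
    and u: "\<And>k. k \<in> W \<Longrightarrow> (\<Sum>j\<in>W. a k j * u j) = 0"
    and v: "\<And>k. k \<in> W \<Longrightarrow> (\<Sum>j\<in>W. a k j * v j) + b k * c = 0" and c: "c \<noteq> 0"
  shows "(\<Sum>k\<in>W. u k * b k) = 0"
proof -
  have "0 = (\<Sum>k\<in>W. u k * ((\<Sum>j\<in>W. a k j * v j) + b k * c))" using v by simp
  also have "\<dots> = (\<Sum>k\<in>W. \<Sum>j\<in>W. v j * (a j k * u k)) + c * (\<Sum>k\<in>W. u k * b k)"
    by (simp add: distrib_left sum.distrib sum_distrib_left sym mult_ac)
  also have "(\<Sum>k\<in>W. \<Sum>j\<in>W. v j * (a j k * u k)) = (\<Sum>j\<in>W. v j * (\<Sum>k\<in>W. a j k * u k))"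
    by (subst sum.swap) (simp add: sum_distrib_left)
  also have "\<dots> = 0" using u by simp
  finally show ?thesis using c by simp
qed

text \<open>
  Here \<open>q\<close> is the \<open>k\<close>-th column of the inverse of \<open>a\<close> and, by symmetry, also its \<open>k\<close>-th row.
\<close>

lemma solve_by_inverse_rows:
  fixes a :: "'a \<Rightarrow> 'a \<Rightarrow> real"
  assumes W: "finite W" and sym: "\<And>k j. a k j = a j k"
    and q: "\<And>l. l \<in> W \<Longrightarrow> (\<Sum>j\<in>W. a l j * q j) = of_bool (l = k)"
    and w: "\<And>l. l \<in> W \<Longrightarrow> (\<Sum>j\<in>W. a l j * w j) = b l" and k: "k \<in> W"
  shows "w k = (\<Sum>l\<in>W. q l * b l)"
proof -
  have "(\<Sum>l\<in>W. q l * b l) = (\<Sum>l\<in>W. \<Sum>j\<in>W. w j * (a j l * q l))"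
    using w by (intro sum.cong refl) (simp add: sum_distrib_left sym mult_ac flip: w)
  also have "\<dots> = (\<Sum>j\<in>W. w j * (\<Sum>l\<in>W. a j l * q l))"
    by (subst sum.swap) (simp add: sum_distrib_left)
  also have "\<dots> = (\<Sum>j\<in>W. if j = k then w j else 0)" using q by (intro sum.cong refl) simp
  also have "\<dots> = w k" using W k by simp
  finally show ?thesis ..
qed

definition pivot :: "('a set \<Rightarrow> bool) \<Rightarrow> 'a set \<Rightarrow> 'a \<Rightarrow> bool" where
  "pivot f V i \<longleftrightarrow> (\<exists>v. v i \<noteq> 0 \<and> (\<forall>k\<in>V. (\<Sum>j\<in>V. adj f k j * v j) = 0))"

text \<open>
  Equivalently, the matrix on \<open>V\<close> has a nonzero vector in its kernel.
\<close>

definition degenerate :: "('a set \<Rightarrow> bool) \<Rightarrow> 'a set \<Rightarrow> bool" where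
  "degenerate f V \<longleftrightarrow> (\<exists>i\<in>V. pivot f V i)"

lemma adj_sym: "adj f i j = adj f j i"
  by (simp add: adj_def insert_commute)

lemma support_of_null_vector:
  assumes "\<not> thin_null f n U T" "finite U" "u \<in> U" "q u \<noteq> 0" "\<And>t. t \<in> T \<Longrightarrow> (\<Sum>j\<in>U. adj f t j * q j) = 0"
  shows "n < 4 * card {j \<in> U. q j \<noteq> 0}"
proof (rule ccontr)
  let ?S = "{j \<in> U. q j \<noteq> 0}"
  assume "\<not> n < 4 * card ?S"
  then have "4 * card ?S \<le> n" by simp
  moreover have "(\<Sum>j\<in>?S. adj f t j * q j) = (\<Sum>j\<in>U. adj f t j * q j)" for t
    using assms(2) by (intro sum.mono_neutral_left) auto
  then have "null_on f ?S T" using assms(5) unfolding null_on_def by (intro exI[of _ q]) auto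
  moreover have "?S \<subseteq> U" "?S \<noteq> {}" using assms(3,4) by auto
  ultimately have "thin_null f n U T" unfolding thin_null_def by (intro exI[of _ ?S] conjI)
  with assms(1) show False by contradiction
qed

lemma adj_cong:
  assumes "\<And>e. e \<subseteq> U \<union> T \<Longrightarrow> f e = g e" "t \<in> T" "u \<in> U"
  shows "adj f t u = adj g t u"
  using assms unfolding adj_def by simp

lemma thin_null_cong:
  assumes ag: "\<And>e. e \<subseteq> U \<union> T \<Longrightarrow> f e = g e"
  shows "thin_null f n U T = thin_null g n U T"
proof -
  have "null_on f S T = null_on g S T" if S: "S \<subseteq> U" for S
  proof -
    have "(\<Sum>u\<in>S. adj f t u * q u) = (\<Sum>u\<in>S. adj g t u * q u)" if "t \<in> T" for t q
      using that S by (intro sum.cong refl arg_cong2[where f="(*)"] adj_cong[of U T f g] ag) auto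
    then show ?thesis unfolding null_on_def by simp
  qed
  then show ?thesis unfolding thin_null_def by blast
qed

lemma degenerate_cong:
  assumes ag: "\<And>e. e \<subseteq> V \<Longrightarrow> f e = g e"
  shows "degenerate f V = degenerate g V"
proof -
  have "(\<Sum>j\<in>V. adj f k j * v j) = (\<Sum>j\<in>V. adj g k j * v j)" if "k \<in> V" for k v
    using that by (intro sum.cong refl arg_cong2[where f="(*)"] adj_cong[of V V f g] ag) auto
  then show ?thesis unfolding degenerate_def pivot_def by simp
qed

text \<open>
  The kernel vector is scaled to have coordinate 1 at \<open>i\<close>; the column of \<open>i\<close> then becomes the right-hand side
  of a system for the other coordinates.
\<close>

lemma pivot_normalize:
  assumes V: "finite V" "i \<in> V" and "pivot f V i"
  obtains w where "\<And>k. k \<in> V - {i} \<Longrightarrow> (\<Sum>j\<in>V - {i}. adj f k j * w j) = - adj f i k"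
    "(\<Sum>j\<in>V - {i}. adj f i j * w j) = - adj f i i"
proof -
  from assms(3) obtain v where v: "v i \<noteq> 0" "\<And>k. k \<in> V \<Longrightarrow> (\<Sum>j\<in>V. adj f k j * v j) = 0"
    unfolding pivot_def by blast
  have "(\<Sum>j\<in>V - {i}. adj f k j * (v j / v i)) = - adj f i k" if "k \<in> V" for k
  proof -
    have "adj f k i * v i + (\<Sum>j\<in>V - {i}. adj f k j * v j) = 0"
      using v(2)[OF that] sum.remove[OF V, of "\<lambda>j. adj f k j * v j"] by simp
    then have "(\<Sum>j\<in>V - {i}. adj f k j * v j) / v i = - adj f i k"
      using v(1) by (simp add: adj_sym[of f k i] field_simps eq_neg_iff_add_eq_0)
    then show ?thesis by (simp add: sum_divide_distrib)
  qed
  then show ?thesis using that[of "\<lambda>j. v j / v i"] V(2) by simp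
qed

section \<open>Adding a vertex\<close>

text \<open>
  \<open>attach x g\<close> is the graph in which the edges at \<open>i\<close> are given by \<open>x\<close> and all other edges by \<open>g\<close>.
\<close>

context
  fixes V :: "'a set" and i :: 'a and n s :: nat and p :: real
  assumes V: "finite V" "card V = n" "i \<in> V" and n: "8 \<le> n"
    and p: "0 < p" "p \<le> 1 / 2" and s: "0 < s" "256 * real s ^ 2 \<le> n * p"
begin

abbreviation (input) "others \<equiv> V - {i}"
abbreviation (input) "star \<equiv> (\<lambda>j. {i, j})"
abbreviation (input) "attach \<equiv> (\<lambda>x g e. if e \<in> star ` others then x (inv_into UNIV star e) else g e)"

lemma inj_star: "inj star"
  by (auto simp: inj_def doubleton_eq_iff)

lemma star_subset: "star ` others \<subseteq> edge_slots V"
  using V by (auto intro!: pair_in_edge_slots)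

lemma star_outside: "e \<subseteq> others \<Longrightarrow> e \<notin> star ` others"
  by auto

lemma adj_attach_old: "k \<in> others \<Longrightarrow> j \<in> others \<Longrightarrow> adj (attach x g) k j = adj g k j"
  using star_outside[of "{k, j}"] by (simp add: adj_def)

lemma adj_attach_new: "k \<in> others \<Longrightarrow> adj (attach x g) i k = of_bool (x k)"
  using inv_f_f[OF inj_star, of k] by (simp add: adj_def)

lemma adj_attach_diag: "adj (attach x g) i i = adj g i i"
proof -
  have "{i, i} \<notin> star ` others" by auto
  then show ?thesis by (simp add: adj_def)
qed

lemma finite_others: "finite others" "card others = n - 1"
  using V by auto

text \<open>
  In this event the matrix without \<open>i\<close> has a kernel vector that is not thin, and the vector of edges at \<open>i\<close> has
  to be orthogonal to it.
\<close>

lemma prob_pivot_degenerate_le: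
  "measure_pmf.prob (coins (edge_slots V) p) {f. pivot f V i \<and> degenerate f others \<and> \<not> thin_null f n others others} \<le> 2 / s"
proof -
  let ?R = "\<lambda>f. degenerate f others \<and> \<not> thin_null f n others others"
  have "measure_pmf.prob (coins (edge_slots V) p) {f. pivot f V i \<and> ?R f}
     \<le> 2 / s * measure_pmf.prob (coins (edge_slots V) p) {f. ?R f}"
  proof (rule prob_coins_condition_le[OF finite_edge_slots[OF V(1)] inj_star star_subset])
    show "0 \<le> 2 / real s" by simp
    show "?R f" if "pivot f V i \<and> ?R f" for f using that by blast
    show "?R g" if ag: "\<And>e. e \<notin> star ` others \<Longrightarrow> f e = g e" and R: "?R f" for f g :: "'a set \<Rightarrow> bool"
    proof -
      have "f e = g e" if "e \<subseteq> others" for e using ag star_outside[OF that] by blast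
      then have "degenerate f others = degenerate g others" "thin_null f n others others = thin_null g n others others"
        by (auto intro!: degenerate_cong thin_null_cong)
      with R show ?thesis by blast
    qed
    fix g assume g: "?R g"
    then obtain j u where u: "j \<in> others" "u j \<noteq> 0" "\<And>k. k \<in> others \<Longrightarrow> (\<Sum>j\<in>others. adj g k j * u j) = 0"
      unfolding degenerate_def pivot_def by blast
    have "n < 4 * card {j \<in> others. u j \<noteq> 0}"
      using g by (intro support_of_null_vector[OF _ finite_others(1) u]) auto
    then have "n * p \<le> (4 * card {j \<in> others. u j \<noteq> 0}) * p" using p by (intro mult_right_mono) auto
    then have "n * p \<le> 4 * (card {j \<in> others. u j \<noteq> 0} * p)" by simp
    moreover have "0 \<le> real s ^ 2" by simp
    ultimately have k: "4 * real s ^ 2 \<le> card {j \<in> others. u j \<noteq> 0} * p" using s(2) by linarith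
    have "measure_pmf.prob (coins others p) {x. pivot (attach x g) V i \<and> ?R (attach x g)}
      \<le> measure_pmf.prob (coins others p) {x. (\<Sum>j\<in>others. u j * of_bool (x j)) = 0}"
    proof (rule measure_pmf.finite_measure_mono)
      show "{x. pivot (attach x g) V i \<and> ?R (attach x g)} \<subseteq> {x. (\<Sum>j\<in>others. u j * of_bool (x j)) = 0}"
      proof safe
        fix x assume "pivot (attach x g) V i"
        then obtain w where w: "\<And>k. k \<in> others \<Longrightarrow> (\<Sum>j\<in>others. adj (attach x g) k j * w j) = - adj (attach x g) i k"
          using pivot_normalize[OF V(1,3)] by blast
        have "(\<Sum>j\<in>others. adj g k j * w j) + of_bool (x k) * 1 = 0" if "k \<in> others" for k
        proof -
          have "(\<Sum>j\<in>others. adj g k j * w j) = (\<Sum>j\<in>others. adj (attach x g) k j * w j)"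
            using that by (intro sum.cong refl) (simp only: adj_attach_old)
          then show ?thesis using w[OF that] adj_attach_new[OF that, of x g] by simp
        qed
        from border_orthogonal_to_kernel[of "adj g", OF adj_sym u(3) this]
        show "(\<Sum>j\<in>others. u j * of_bool (x j)) = 0" by simp
      qed
    qed simp
    also have "\<dots> \<le> 2 / s" by (rule littlewood_offord[OF finite_others(1) p s(1) k])
    finally show "measure_pmf.prob (coins others p) {x. pivot (attach x g) V i \<and> ?R (attach x g)} \<le> 2 / s" .
  qed
  also have "\<dots> \<le> 2 / s * 1" by (intro mult_left_mono) auto
  finally show ?thesis by simp
qed

text \<open>
  Let \<open>Q\<close> be the inverse of the matrix without \<open>i\<close>.  Eliminating the other coordinates turns the equation of row \<open>i\<close> into
  a quadratic equation with matrix \<open>Q\<close> for the edges at \<open>i\<close>.  Row \<open>j\<close> of \<open>Q\<close> is annihilated by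
  all rows except \<open>j\<close>, so it has more than \<open>n/4\<close> nonzero entries unless there is a thin vector with this
  property.  The set \<open>U2\<close>, on which the equation is to become linear, has only about \<open>n/8\<close> elements, so
  that at least \<open>n/8\<close> of these entries lie outside it.
\<close>

lemma prob_pivot_nondegenerate_le:
  assumes U2: "U2 \<subseteq> others" "card U2 = n div 8"
  shows "measure_pmf.prob (coins (edge_slots V) p) {f. pivot f V i \<and> \<not> degenerate f others
      \<and> \<not> card U2 / 2 \<le> real (card {j \<in> U2. thin_null f n others (others - {j})})} \<le> sqrt (6 / s)"
proof -
  let ?many = "\<lambda>f. card U2 / 2 \<le> real (card {j \<in> U2. thin_null f n others (others - {j})})"
  let ?R = "\<lambda>f. \<not> degenerate f others \<and> \<not> ?many f"
  have "measure_pmf.prob (coins (edge_slots V) p) {f. pivot f V i \<and> ?R f}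
     \<le> sqrt (6 / s) * measure_pmf.prob (coins (edge_slots V) p) {f. ?R f}"
  proof (rule prob_coins_condition_le[OF finite_edge_slots[OF V(1)] inj_star star_subset])
    show "0 \<le> sqrt (6 / real s)" by simp
    show "?R f" if "pivot f V i \<and> ?R f" for f using that by blast
    show "?R g" if ag: "\<And>e. e \<notin> star ` others \<Longrightarrow> f e = g e" and R: "?R f" for f g :: "'a set \<Rightarrow> bool"
    proof -
      have eq: "f e = g e" if "e \<subseteq> others" for e using ag star_outside[OF that] by blast
      then have "degenerate f others = degenerate g others" by (rule degenerate_cong)
      moreover have "thin_null f n others (others - {j}) = thin_null g n others (others - {j})" for j
        by (rule thin_null_cong) (rule eq, blast)
      ultimately show ?thesis using R by simp
    qed
    fix g assume g: "?R g"
    have inj: "w l = 0" if ker: "\<And>k. k \<in> others \<Longrightarrow> (\<Sum>j\<in>others. adj g k j * w j) = 0" and "l \<in> others" for w l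
      using g that unfolding degenerate_def pivot_def by blast
    have "\<forall>k. \<exists>w. \<forall>l\<in>others. (\<Sum>j\<in>others. adj g l j * w j) = of_bool (l = k)"
      by (intro allI square_system_solvable[OF finite_others(1) finite_others(1) refl]) (rule inj)
    from choice[OF this] obtain Q
      where "\<forall>k. \<forall>l\<in>others. (\<Sum>j\<in>others. adj g l j * Q k j) = of_bool (l = k)" ..
    then have Q: "(\<Sum>j\<in>others. adj g l j * Q k j) = of_bool (l = k)" if "l \<in> others" for k l
      using that by blast
    have Qsolve: "w k = (\<Sum>l\<in>others. Q k l * b l)"
      if "k \<in> others" "\<And>l. l \<in> others \<Longrightarrow> (\<Sum>j\<in>others. adj g l j * w j) = b l" for w b k
      by (rule solve_by_inverse_rows[OF finite_others(1), of "adj g", OF adj_sym Q that(2,1)])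
    have Qsym: "Q k l = Q l k" if "k \<in> others" "l \<in> others" for k l
    proof -
      have "Q l k = (\<Sum>m\<in>others. Q k m * of_bool (m = l))" by (rule Qsolve[OF that(1)]) (rule Q)
      also have "\<dots> = (\<Sum>m\<in>others. if m = l then Q k m else 0)" by (intro sum.cong refl) simp
      also have "\<dots> = Q k l" using finite_others(1) that(2) by simp
      finally show ?thesis ..
    qed
    define G where "G = {j \<in> U2. \<not> thin_null g n others (others - {j})}"
    have finU2: "finite U2" using finite_subset[OF U2(1) finite_others(1)] .
    have "card U2 = card {j \<in> U2. thin_null g n others (others - {j})} + card G"
      unfolding G_def using finU2 by (subst card_Un_disjoint[symmetric]) (auto intro: arg_cong[where f=card])
    then have "card U2 / 2 \<le> card G" using g by simp
    moreover have "n \<le> 16 * (n div 8)" using n by presburger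
    then have "n \<le> 16 * real (card U2)" unfolding U2(2) by (metis of_nat_le_iff of_nat_mult of_nat_numeral)
    ultimately have cG: "n / 32 \<le> card G" by simp
    have rows: "4 * real s ^ 2 \<le> card {u \<in> others - U2. Q j u \<noteq> 0} * p" if j: "j \<in> G" for j
    proof -
      have jW: "j \<in> others" using j U2(1) by (auto simp: G_def)
      have "\<exists>u\<in>others. Q j u \<noteq> 0"
      proof (rule ccontr)
        assume "\<not> (\<exists>u\<in>others. Q j u \<noteq> 0)"
        then show False using Q[OF jW, of j] by simp
      qed
      then obtain u where u: "u \<in> others" "Q j u \<noteq> 0" by blast
      have "n < 4 * card {u \<in> others. Q j u \<noteq> 0}"
        using j by (intro support_of_null_vector[where q="Q j", OF _ finite_others(1) u, of g n "others - {j}"]) (auto simp: G_def Q)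
      also have "card {u \<in> others. Q j u \<noteq> 0} \<le> card ({u \<in> others - U2. Q j u \<noteq> 0} \<union> U2)"
        using finite_others(1) finU2 by (intro card_mono) auto
      also have "\<dots> \<le> card {u \<in> others - U2. Q j u \<noteq> 0} + n div 8" unfolding U2(2)[symmetric] by (rule card_Un_le)
      finally have "n < 4 * card {u \<in> others - U2. Q j u \<noteq> 0} + 4 * (n div 8)" by simp
      then have "n \<le> 8 * card {u \<in> others - U2. Q j u \<noteq> 0}" by linarith
      then have "real n \<le> 8 * card {u \<in> others - U2. Q j u \<noteq> 0}" by linarith
      then have "n * p \<le> (8 * card {u \<in> others - U2. Q j u \<noteq> 0}) * p" using p by (intro mult_right_mono) auto
      then have "n * p \<le> 8 * (card {u \<in> others - U2. Q j u \<noteq> 0} * p)" by simp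
      then have "256 * real s ^ 2 \<le> 8 * (card {u \<in> others - U2. Q j u \<noteq> 0} * p)" using s(2) by linarith
      moreover have "0 \<le> real s ^ 2" by simp
      ultimately show ?thesis by linarith
    qed
    have many: "8 * real s ^ 2 \<le> card G * p"
    proof -
      have "n / 32 * p \<le> card G * p" using cG p by (intro mult_right_mono) auto
      then show ?thesis using s by simp
    qed
    have "measure_pmf.prob (coins others p) {x. pivot (attach x g) V i \<and> ?R (attach x g)}
      \<le> measure_pmf.prob (coins others p) {x. (\<Sum>k\<in>others. \<Sum>l\<in>others. Q k l * of_bool (x k) * of_bool (x l)) = adj g i i}"
    proof (rule measure_pmf.finite_measure_mono)
      show "{x. pivot (attach x g) V i \<and> ?R (attach x g)}
         \<subseteq> {x. (\<Sum>k\<in>others. \<Sum>l\<in>others. Q k l * of_bool (x k) * of_bool (x l)) = adj g i i}"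
      proof
        fix x assume "x \<in> {x. pivot (attach x g) V i \<and> ?R (attach x g)}"
        then have "pivot (attach x g) V i" by blast
        then obtain w where w: "\<And>k. k \<in> others \<Longrightarrow> (\<Sum>j\<in>others. adj (attach x g) k j * w j) = - adj (attach x g) i k"
          "(\<Sum>j\<in>others. adj (attach x g) i j * w j) = - adj (attach x g) i i"
          using pivot_normalize[OF V(1,3)] by blast
        have old: "(\<Sum>j\<in>others. adj g k j * w j) = - of_bool (x k)" if "k \<in> others" for k
        proof -
          have "(\<Sum>j\<in>others. adj g k j * w j) = (\<Sum>j\<in>others. adj (attach x g) k j * w j)"
            using that by (intro sum.cong refl) (simp only: adj_attach_old)
          then show ?thesis using w(1)[OF that] adj_attach_new[OF that, of x g] by simp
        qed
        have wk: "w k = (\<Sum>l\<in>others. Q k l * - of_bool (x l))" if "k \<in> others" for k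
          by (rule Qsolve[OF that old])
        have "adj g i i = - (\<Sum>k\<in>others. adj (attach x g) i k * w k)" using w(2) adj_attach_diag[of x g] by simp
        also have "(\<Sum>k\<in>others. adj (attach x g) i k * w k) = (\<Sum>k\<in>others. of_bool (x k) * (\<Sum>l\<in>others. Q k l * - of_bool (x l)))"
          by (intro sum.cong refl) (simp only: adj_attach_new wk)
        also have "- \<dots> = (\<Sum>k\<in>others. \<Sum>l\<in>others. Q k l * of_bool (x k) * of_bool (x l))"
          by (simp add: sum_distrib_left sum_negf mult_ac)
        finally show "x \<in> {x. (\<Sum>k\<in>others. \<Sum>l\<in>others. Q k l * of_bool (x k) * of_bool (x l)) = adj g i i}" by simp
      qed
    qed simp
    also have "\<dots> \<le> sqrt (6 / s)"
      by (rule quadratic_littlewood_offord[OF finite_others(1) _ _ p Qsym s(1) rows many]) (use U2 in \<open>auto simp: G_def\<close>)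
    finally show "measure_pmf.prob (coins others p) {x. pivot (attach x g) V i \<and> ?R (attach x g)} \<le> sqrt (6 / s)" .
  qed
  also have "\<dots> \<le> sqrt (6 / s) * 1" by (intro mult_left_mono) auto
  finally show ?thesis by simp
qed

text \<open>
  The summand \<open>3 * e\<close>: one \<open>e\<close> is spent on thin kernel vectors of the matrix without \<open>i\<close>, and \<open>2 * e\<close> on
  the event that half of the columns in \<open>U2\<close> are exceptional, by Markov's inequality.
\<close>

lemma prob_pivot_le:
  assumes thin: "\<And>U T. U \<subseteq> V \<Longrightarrow> T \<subseteq> V \<Longrightarrow> n \<le> card T + 2
     \<Longrightarrow> measure_pmf.prob (coins (edge_slots V) p) {f. thin_null f n U T} \<le> e"
  shows "measure_pmf.prob (coins (edge_slots V) p) {f. pivot f V i} \<le> 3 * e + 2 / s + sqrt (6 / s)"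
proof -
  let ?P = "measure_pmf.prob (coins (edge_slots V) p)"
  have "n div 8 \<le> card others" using finite_others(2) n by linarith
  then obtain U2 where U2: "U2 \<subseteq> others" "card U2 = n div 8" by (meson obtain_subset_with_card_n)
  have finU2: "finite U2" using finite_subset[OF U2(1) finite_others(1)] .
  have pos: "0 < card U2" using U2(2) n by simp
  let ?many = "\<lambda>f. card U2 / 2 \<le> real (card {j \<in> U2. thin_null f n others (others - {j})})"
  let ?A = "{f. thin_null f n others others}" and ?B = "{f. pivot f V i \<and> degenerate f others \<and> \<not> thin_null f n others others}"
    and ?C = "{f. ?many f}" and ?D = "{f. pivot f V i \<and> \<not> degenerate f others \<and> \<not> ?many f}"
  have "?P {f. pivot f V i} \<le> ?P ((?A \<union> ?B) \<union> (?C \<union> ?D))"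
    by (rule measure_pmf.finite_measure_mono) auto
  also have "\<dots> \<le> ?P (?A \<union> ?B) + ?P (?C \<union> ?D)" by (rule measure_Un_le) simp_all
  also have "\<dots> \<le> (?P ?A + ?P ?B) + (?P ?C + ?P ?D)" by (intro add_mono measure_Un_le) simp_all
  also have "\<dots> \<le> (e + 2 / s) + (2 * e + sqrt (6 / s))"
  proof (intro add_mono)
    show "?P ?A \<le> e" using finite_others(2) by (intro thin) auto
    show "?P ?B \<le> 2 / s" by (rule prob_pivot_degenerate_le)
    show "?P ?D \<le> sqrt (6 / s)" by (rule prob_pivot_nondegenerate_le[OF U2])
    have "?P ?C \<le> card U2 * e / (card U2 / 2)"
    proof (rule prob_many_le[OF finU2])
      show "0 < card U2 / 2" using pos by simp
      fix j assume "j \<in> U2"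
      then have "j \<in> others" using U2 by blast
      then have "card (others - {j}) = n - 2" using finite_others by simp
      then show "?P {f. thin_null f n others (others - {j})} \<le> e" by (intro thin) auto
    qed
    also have "\<dots> = 2 * e" using pos by simp
    finally show "?P ?C \<le> 2 * e" .
  qed
  finally show ?thesis by simp
qed

end

text \<open>
  A kernel vector that is not thin produces more than \<open>n/4\<close> vertices with the property \<open>pivot\<close>,
  which costs a factor 4 by Markov's inequality.
\<close>

lemma prob_degenerate_le:
  fixes V :: "'a set" and p e :: real
  assumes V: "finite V" "card V = n" and n: "8 \<le> n"
    and p: "0 < p" "p \<le> 1 / 2" and s: "0 < s" "256 * real s ^ 2 \<le> n * p"
    and thin: "\<And>U T. U \<subseteq> V \<Longrightarrow> T \<subseteq> V \<Longrightarrow> n \<le> card T + 2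
     \<Longrightarrow> measure_pmf.prob (coins (edge_slots V) p) {f. thin_null f n U T} \<le> e"
  shows "measure_pmf.prob (coins (edge_slots V) p) {f. degenerate f V} \<le> 13 * e + 4 * (2 / s + sqrt (6 / s))"
proof -
  let ?P = "measure_pmf.prob (coins (edge_slots V) p)"
  let ?many = "\<lambda>f. n / 4 \<le> real (card {i \<in> V. pivot f V i})"
  have "?P {f. degenerate f V} \<le> ?P ({f. thin_null f n V V} \<union> {f. ?many f})"
  proof (rule measure_pmf.finite_measure_mono)
    show "{f. degenerate f V} \<subseteq> {f. thin_null f n V V} \<union> {f. ?many f}"
    proof
      fix f assume "f \<in> {f. degenerate f V}"
      then obtain i v where v: "i \<in> V" "v i \<noteq> 0" "\<And>k. k \<in> V \<Longrightarrow> (\<Sum>j\<in>V. adj f k j * v j) = 0"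
        unfolding degenerate_def pivot_def by blast
      show "f \<in> {f. thin_null f n V V} \<union> {f. ?many f}"
      proof (cases "thin_null f n V V")
        case False
        then have "n < 4 * card {j \<in> V. v j \<noteq> 0}" by (rule support_of_null_vector[OF _ V(1) v])
        also have "card {j \<in> V. v j \<noteq> 0} \<le> card {i \<in> V. pivot f V i}"
          using V v(3) by (intro card_mono) (auto simp: pivot_def)
        finally show ?thesis by simp
      qed simp
    qed
  qed simp
  also have "\<dots> \<le> ?P {f. thin_null f n V V} + ?P {f. ?many f}" by (rule measure_Un_le) simp_all
  also have "?P {f. ?many f} \<le> card V * (3 * e + 2 / s + sqrt (6 / s)) / (n / 4)"
    using n by (intro prob_many_le[OF V(1)] prob_pivot_le[OF V _ n p s thin]) auto
  also have "\<dots> = 4 * (3 * e + 2 / s + sqrt (6 / s))" using n V(2) by simp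
  also have "?P {f. thin_null f n V V} \<le> e" using V by (intro thin) auto
  finally show ?thesis by simp
qed

section \<open>The random graph\<close>

lemma singular_imp_degenerate:
  assumes f: "\<And>e. e \<notin> vertex_pairs n \<Longrightarrow> \<not> f e"
    and sing: "\<not> nonsingular_graph n {e \<in> vertex_pairs n. f e}"
  shows "degenerate f {1..n}"
proof -
  let ?A = "adjacency_matrix n {e \<in> vertex_pairs n. f e}"
  have A: "?A \<in> carrier_mat n n" by (simp add: adjacency_matrix_def)
  have "det ?A = 0"
  proof (rule ccontr)
    assume "det ?A \<noteq> 0"
    from det_non_zero_imp_unit[OF A this, of "()"] obtain B
      where B: "B \<in> carrier_mat n n" "B * ?A = 1\<^sub>m n" "?A * B = 1\<^sub>m n"
      unfolding Units_def ring_mat_def by auto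
    then have "invertible_mat ?A"
      using A unfolding invertible_mat_def inverts_mat_def by (auto intro!: exI[of _ B])
    with sing show False by (simp add: nonsingular_graph_def)
  qed
  then obtain v where v: "v \<in> carrier_vec n" "v \<noteq> 0\<^sub>v n" "?A *\<^sub>v v = 0\<^sub>v n"
    using det_0_iff_vec_prod_zero_field[OF A] by blast
  have entry: "?A $$ (i, j) = adj f (Suc i) (Suc j)" if "i < n" "j < n" for i j
    using that f by (auto simp: adjacency_matrix_def adj_def)
  have row: "(\<Sum>j<n. adj f (Suc i) (Suc j) * v $ j) = 0" if i: "i < n" for i
  proof -
    have "(\<Sum>j<n. adj f (Suc i) (Suc j) * v $ j) = (\<Sum>j<n. ?A $$ (i, j) * v $ j)"
      using i entry by (intro sum.cong) auto
    also have "\<dots> = (?A *\<^sub>v v) $ i"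
      using A v(1) i by (simp add: scalar_prod_def lessThan_atLeast0)
    also have "\<dots> = 0" using v(3) i by simp
    finally show ?thesis .
  qed
  obtain i where i: "i < n" "v $ i \<noteq> 0"
    using v(1,2) by (metis carrier_vecD eq_vecI index_zero_vec)
  have "pivot f {1..n} (Suc i)"
    unfolding pivot_def
  proof (intro exI[of _ "\<lambda>j. v $ (j - 1)"] conjI ballI)
    show "v $ (Suc i - 1) \<noteq> 0" using i by simp
    fix k assume "k \<in> {1..n}"
    then have "k = Suc (k - 1)" "k - 1 < n" by auto
    then show "(\<Sum>j\<in>{1..n}. adj f k j * v $ (j - 1)) = 0"
      using row[of "k - 1"] by (simp add: sum.atLeast1_atMost_eq)
  qed
  then show ?thesis unfolding degenerate_def using i(1) by (intro bexI[of _ "Suc i"]) auto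
qed

text \<open>
  The flips outside the set of vertex pairs are almost surely \<open>False\<close>, so the diagonal vanishes as in the
  adjacency matrix.
\<close>

lemma prob_singular_le:
  "measure_pmf.prob (erdos_renyi n p) {E. \<not> nonsingular_graph n E}
     \<le> measure_pmf.prob (coins (edge_slots {1..n}) p) {f. degenerate f {1..n}}"
proof -
  have vp: "edge_slots {1..n} = vertex_pairs n" by (simp add: edge_slots_def vertex_pairs_def)
  let ?M = "coins (vertex_pairs n) p"
  let ?S = "{f. \<not> nonsingular_graph n {e \<in> vertex_pairs n. f e}}"
  have "measure_pmf.prob (erdos_renyi n p) {E. \<not> nonsingular_graph n E} = measure_pmf.prob ?M ?S"
    by (simp add: erdos_renyi_def coins_def vimage_def)
  also have "\<dots> = measure_pmf.prob ?M (?S \<inter> set_pmf ?M)" by (simp add: measure_Int_set_pmf)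
  also have "\<dots> \<le> measure_pmf.prob ?M {f. degenerate f {1..n}}"
  proof (rule measure_pmf.finite_measure_mono)
    have "finite (vertex_pairs n)" unfolding vp[symmetric] by (simp add: finite_edge_slots)
    then have "set_pmf ?M \<subseteq> {f. \<forall>e. e \<notin> vertex_pairs n \<longrightarrow> f e = False}"
      unfolding coins_def by (rule set_Pi_pmf_subset)
    then show "?S \<inter> set_pmf ?M \<subseteq> {f. degenerate f {1..n}}"
      using singular_imp_degenerate by blast
  qed simp
  finally show ?thesis unfolding vp .
qed

theorem corollary1p5:
  fixes c :: real and p :: "nat \<Rightarrow> real"
  assumes "c > 1"
    and "eventually (\<lambda>n. c * ln (real n) / real n < p n \<and> p n < 1 / 2) sequentially"
  shows "(\<lambda>n. measure_pmf.prob (erdos_renyi n (p n)) {E. nonsingular_graph n E}) \<longlonglongrightarrow> 1"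
proof -
  let ?P = "\<lambda>n. measure_pmf.prob (erdos_renyi n (p n))"
  have small: "eventually (\<lambda>n. ?P n {E. \<not> nonsingular_graph n E} < r) sequentially" if r: "r > 0" for r :: real
  proof -
    have "(\<lambda>s::nat. 4 * (2 / s + sqrt (6 / s))) \<longlonglongrightarrow> 0" by real_asymp
    then have "eventually (\<lambda>s::nat. 4 * (2 / s + sqrt (6 / s)) < r / 2) sequentially"
      by (rule order_tendstoD(2)) (use r in simp)
    then have "eventually (\<lambda>s::nat. 4 * (2 / s + sqrt (6 / s)) < r / 2 \<and> 0 < s) sequentially"
      using eventually_gt_at_top[of "0::nat"] by eventually_elim simp
    then obtain s :: nat where s: "4 * (2 / s + sqrt (6 / s)) < r / 2" "0 < s"
      by (auto dest: eventually_happens)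
    have "eventually (\<lambda>n. \<forall>(V :: nat set) U T p. finite V \<longrightarrow> card V = n \<longrightarrow> U \<subseteq> V \<longrightarrow> T \<subseteq> V
        \<longrightarrow> n \<le> card T + 2 \<longrightarrow> c * ln n / n < p \<longrightarrow> p \<le> 1 / 2
        \<longrightarrow> measure_pmf.prob (coins (edge_slots V) p) {f. thin_null f n U T} \<le> r / 26) sequentially"
      using assms(1) r by (intro thin_null_unlikely) auto
    moreover have "eventually (\<lambda>n::nat. 256 * real s ^ 2 \<le> ln n) sequentially" by real_asymp
    moreover have "eventually (\<lambda>n::nat. 8 \<le> n) sequentially" by (rule eventually_ge_at_top)
    ultimately show ?thesis
      using assms(2)
    proof eventually_elim
      case (elim n)
      have pn: "c * ln n / n < p n" "p n \<le> 1 / 2" using elim(4) by auto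
      have lnpos: "0 \<le> ln n" using elim(3) by simp
      have "0 \<le> c * ln n / n" using lnpos assms(1) by simp
      then have p0: "0 < p n" using pn(1) by linarith
      have "c * ln n \<le> n * p n" using pn(1) elim(3) by (simp add: field_simps)
      moreover have "1 * ln n \<le> c * ln n" using lnpos assms(1) by (intro mult_right_mono) auto
      ultimately have np: "256 * real s ^ 2 \<le> n * p n" using elim(2) by linarith
      have "?P n {E. \<not> nonsingular_graph n E}
          \<le> measure_pmf.prob (coins (edge_slots {1..n}) (p n)) {f. degenerate f {1..n}}"
        by (rule prob_singular_le)
      also have "\<dots> \<le> 13 * (r / 26) + 4 * (2 / s + sqrt (6 / s))"
        using elim(1) pn by (intro prob_degenerate_le[OF _ _ elim(3) p0 pn(2) s(2) np]) auto
      also have "\<dots> < r" using s(1) by simp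
      finally show ?case .
    qed
  qed
  show ?thesis
  proof (rule tendstoI)
    fix r :: real assume "0 < r"
    from small[OF this]
    show "eventually (\<lambda>n. dist (?P n {E. nonsingular_graph n E}) 1 < r) sequentially"
    proof eventually_elim
      case (elim n)
      have "{E. \<not> nonsingular_graph n E} = UNIV - {E. nonsingular_graph n E}" by blast
      then have "?P n {E. \<not> nonsingular_graph n E} = 1 - ?P n {E. nonsingular_graph n E}"
        using measure_pmf.prob_compl[of "{E. nonsingular_graph n E}" "erdos_renyi n (p n)"] by simp
      then show ?case using elim by (simp add: dist_real_def)
    qed
  qed
qed

end
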